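(* Let $\Omega\subset\mathbb{R}^d$ be a bounded domain with diameter $R:=\sup_{x,y\in\Omega}\|x-y\|_\infty$, and consider a uniform Cartesian grid of $\overline\Omega$ with discretization step $\Delta x>0$ (see context). Let $\nu_1,\dots,\nu_d>0$, $\lambda_b>0$, and let $\mathcal{R}:\mathbb{R}^V\to\mathbb{R}^V$ be $$\mathcal{R}(u)_j:=\begin{cases}\displaystyle\sum_{\ell=1}^d\nu_\ell\,\frac{2u_j-u_{j-e_\ell}-u_{j+e_\ell}}{\Delta x^2}+\mathcal{H}(x_j,u_j,\nabla_G u_j),& j\in\mathcal{J},\\ \lambda_b(u_j-g_j),& j\in\mathcal{B},\end{cases}$$ with $\mathcal{H}$ satisfying (H1) and (H2). Then: (i) There exists a unique $\bar u\in\mathbb{R}^V$ such that $\mathcal{R}(\bar u)=0$, and this solution is the unique critical point of the functional $L(u):=\|\mathcal{R}(u)\|_{\ell^2(V)}^2$ (i.e. the unique $u$ with $0\in\partial L(u)$). (ii) Assume there exists $\ell^\ast\in\{1,\dots,d\}$ such that $$\Delta x\le\frac{\sqrt3\,\nu_{\ell^\ast}}{2[\mathcal{H}]_p}\,e^{-\frac{[\mathcal{H}]_p}{\nu_{\ell^\ast}}R}.$$ Then, for any $u\in\mathbb{R}^V$, $$\|u-\bar u\|_{\ell^\infty(V)}\le\Big(\frac{\nu_{\ell^\ast}}{2[\mathcal{H}]_p^2}\,e^{\frac{2[\mathcal{H}]_p}{\nu_{\ell^\ast}}R}+\frac1{\lambda_b}\Big)\|\mathcal{R}(u)\|_{\ell^\infty(V)}.$$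 (iii) Furthermore, if $$\Delta x\sum_{\ell=1}^d\nu_\ell>[\mathcal{H}]_pR^2d\qquad\text{and}\qquad\lambda_b\ge\frac{2d(\nu_{\max}+[\mathcal{H}]_p\Delta x)}{\Delta x^2},\qquad \nu_{\max}:=\max_{\ell}\nu_\ell,$$ then, with $m:=\frac4{R^2}\sum_{\ell=1}^d\nu_\ell-\frac{4[\mathcal{H}]_p d}{\Delta x}$, $$\|u-\bar u\|_{\ell^2(V)}^2\le\Big(\frac2{m^2}+\frac1{\lambda_b^2}\Big)L(u)\qquad\forall u\in\mathbb{R}^V,$$ together with the generalized Polyak--Łojasiewicz inequality $$\|w\|_{\ell^2(V)}^2\ge\Big(\frac1{2m^2}+\frac1{4\lambda_b^2}\Big)^{-1}L(u)\qquad\forall u\in\mathbb{R}^V,\ \forall w\in\partial L(u).$$ Moreover, for any $u\in\mathbb{R}^V$ and $A\in\partial\mathcal{R}(u)$, $$\kappa(A):=\|A\|_{\ell^2(V)}\|A^{-1}\|_{\ell^2(V)}\le\Big(\frac2{m^2}+\frac1{\lambda_b^2}\Big)^{1/2}\max\Big\{4\Big(\frac1{\Delta x^2}+\frac1{R^2}\Big)\sum_{\ell=1}^d\nu_\ell+[\mathcal{H}]_u,\ 2\lambda_b\Big\}.$$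
   Context: Grid. A uniform Cartesian grid of $\overline\Omega$ with step $\Delta x$: $V\subset\mathbb{Z}^d$ is a bounded (finite) set of multi-indices, the nodes are $x_j=j\,\Delta x\in\overline\Omega$ for $j\in V$, and $V=\mathcal{J}\sqcup\mathcal{B}$ with $\mathcal{J},\mathcal{B}$ non-empty. Each interior index $j\in\mathcal{J}$ has exactly the $2d$ neighbors $\mathcal{V}_j=\{j\pm e_k:k=1,\dots,d\}\subset V$, where $\{e_k\}$ is the canonical basis; boundary indices $j\in\mathcal{B}$ have $\mathcal{V}_j=\emptyset$. The numerical gradient at $j\in\mathcal{J}$ is $\nabla_G u_j:=\{(u_j-u_k)/\Delta x\}_{k\in\mathcal{V}_j}\in\mathbb{R}^{2d}$. For each $j\in\mathcal{J}$, $\mathcal{H}(x_j,\cdot,\cdot):\mathbb{R}\times\mathbb{R}^{2d}\to\mathbb{R}$ is given, as are boundary values $\{g_j\}_{j\in\mathcal{B}}$. Hypotheses. (H1) There are constants $[\mathcal{H}]_u,[\mathcal{H}]_p>0$, independent of $x_j$, such that $|\mathcal{H}(x_j,u,p)-\mathcal{H}(x_j,v,p)|\le[\mathcal{H}]_u|u-v|$ and $|\mathcal{H}(x_j,u,p)-\mathcal{H}(x_j,u,q)|\le[\mathcal{H}]_p\|p-q\|_\infty$ for all $j\in\mathcal{J}$, $u,v\in\mathbb{R}$, $p,q\in\mathbb{R}^{2d}$. (H2) For all $j\in\mathcal{J}$, $u,v\in\mathbb{R}$, $p,q\in\mathbb{R}^{2d}$: $p\le q$ componentwise implies $\mathcal{H}(x_j,u,p)\le\mathcal{H}(x_j,u,q)$;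 and $u\le v$ implies $\mathcal{H}(x_j,u,p)\le\mathcal{H}(x_j,v,p)$. Generalized differentials: $\partial\mathcal{R}(u)$ is the convex hull of all limits of Jacobian matrices $D\mathcal{R}(u_n)$ over sequences $(u_n)$ of differentiability points of $\mathcal{R}$ converging to $u$; $\partial L(u)$ (Clarke generalized gradient) is the convex hull of all limits of $\nabla L(u_n)$ over sequences of differentiability points of $L$ converging to $u$. For vectors $\|\cdot\|_{\ell^2(V)},\|\cdot\|_{\ell^\infty(V)}$ are the Euclidean and maximum norms on $\mathbb{R}^V$; for matrices $\|\cdot\|_{\ell^2(V)}$ is the induced operator norm. *)

theory Defs
  imports "HOL-Analysis.Analysis"
begin

definition generalized_jacobian ::
    "(real ^ 'n::finite \<Rightarrow> real ^ 'm::finite) \<Rightarrow> real ^ 'n \<Rightarrow> (real ^ 'n ^ 'm) set" where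
  "generalized_jacobian f u = convex hull
     {A. \<exists>us. (\<forall>n. f differentiable (at (us n))) \<and> us \<longlonglongrightarrow> u \<and>
               (\<lambda>n. jacobian f (at (us n))) \<longlonglongrightarrow> A}"

definition clarke_gradient :: "(real ^ 'n::finite \<Rightarrow> real) \<Rightarrow> real ^ 'n \<Rightarrow> (real ^ 'n) set" where
  "clarke_gradient f u = convex hull
     {w. \<exists>us ws. (\<forall>n. GDERIV f (us n) :> ws n) \<and> us \<longlonglongrightarrow> u \<and> ws \<longlonglongrightarrow> w}"

definition sup_diameter :: "(real ^ 'd::finite) set \<Rightarrow> real" where
  "sup_diameter S = (SUP (x, y)\<in>S \<times> S. infnorm (x - y))"

definition node :: "real \<Rightarrow> int ^ 'd::finite \<Rightarrow> real ^ 'd" where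
  "node dx j = (\<chi> k. dx * real_of_int (j $ k))"

text \<open>
  The \<open>2 d\<close> neighbours of \<open>j\<close> are \<open>j + shift (k, s)\<close>, with \<open>s = True\<close> for the direction \<open>+ e_k\<close> and
  \<open>s = False\<close> for \<open>- e_k\<close>.  Accordingly $\mathbb{R}^{2d}$ is \<open>real ^ ('d \<times> bool)\<close>.
\<close>

definition shift :: "'d::finite \<times> bool \<Rightarrow> int ^ 'd" where
  "shift = (\<lambda>(k, s). axis k (if s then 1 else - 1))"

text \<open>
  The finite set of multi-indices is \<open>V = J \<union> B\<close>.  To have $\mathbb{R}^V$ as a Euclidean
  space it is enumerated bijectively by a finite type \<open>'v\<close> through \<open>\<iota>\<close>, so that
  $\mathbb{R}^V$ is \<open>real ^ 'v\<close>; in particular $V$ is finite.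
\<close>

definition uniform_grid ::
    "(real ^ 'd::finite) set \<Rightarrow> real \<Rightarrow> (int ^ 'd) set \<Rightarrow> (int ^ 'd) set \<Rightarrow>
     ('v::finite \<Rightarrow> int ^ 'd) \<Rightarrow> bool" where
  "uniform_grid \<Omega> dx J B \<iota> \<longleftrightarrow>
     0 < dx \<and> bij_betw \<iota> UNIV (J \<union> B) \<and> J \<inter> B = {} \<and> J \<noteq> {} \<and> B \<noteq> {} \<and>
     (\<forall>j\<in>J \<union> B. node dx j \<in> closure \<Omega>) \<and>
     (\<forall>j\<in>J. \<forall>k. j + shift k \<in> J \<union> B)"

text \<open>The component of index \<open>j\<close> of a grid function \<open>u\<close>; meaningful only for \<open>j\<close> in the range of \<open>\<iota>\<close>.\<close>

definition grid_val :: "('v::finite \<Rightarrow> int ^ 'd::finite) \<Rightarrow> real ^ 'v \<Rightarrow> int ^ 'd \<Rightarrow> real" where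
  "grid_val \<iota> u j = u $ (inv \<iota> j)"

definition num_gradient ::
    "('v::finite \<Rightarrow> int ^ 'd::finite) \<Rightarrow> real \<Rightarrow> real ^ 'v \<Rightarrow> int ^ 'd \<Rightarrow> real ^ ('d \<times> bool)" where
  "num_gradient \<iota> dx u j = (\<chi> k. (grid_val \<iota> u j - grid_val \<iota> u (j + shift k)) / dx)"

definition residual ::
    "('v::finite \<Rightarrow> int ^ 'd::finite) \<Rightarrow> (int ^ 'd) set \<Rightarrow> real \<Rightarrow> ('d \<Rightarrow> real) \<Rightarrow> real \<Rightarrow>
     (real ^ 'd \<Rightarrow> real \<Rightarrow> real ^ ('d \<times> bool) \<Rightarrow> real) \<Rightarrow> (int ^ 'd \<Rightarrow> real) \<Rightarrow>
     real ^ 'v \<Rightarrow> real ^ 'v" where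
  "residual \<iota> J dx \<nu> lb H g u = (\<chi> i. let j = \<iota> i in
     if j \<in> J then
       (\<Sum>l\<in>UNIV. \<nu> l * ((2 * grid_val \<iota> u j - grid_val \<iota> u (j - axis l 1) - grid_val \<iota> u (j + axis l 1)) / dx\<^sup>2))
       + H (node dx j) (grid_val \<iota> u j) (num_gradient \<iota> dx u j)
     else lb * (grid_val \<iota> u j - g j))"

definition op_norm2 :: "real ^ 'n::finite ^ 'm::finite \<Rightarrow> real" where
  "op_norm2 A = onorm ((*v) A)"

definition condition_number :: "real ^ 'n::finite ^ 'n \<Rightarrow> real" where
  "condition_number A = op_norm2 A * op_norm2 (matrix_inv A)"

end

theory Submission
  imports Defs
begin

text \<open>
  \<^bold>\<open>Linearization by secants.\<close> The Hamiltonian is monotone and Lipschitz, so every increment \<open>F u - F v\<close> equals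
  \<open>A (u - v)\<close> for a matrix \<open>A\<close> with non-positive off-diagonal entries: an interior row carries the
  weights \<open>\<nu> / dx\<^sup>2 + c / dx\<close> with slopes \<open>c \<ge> 0\<close> of sum at most \<open>Hp\<close>, plus a number \<open>h\<close> between \<open>0\<close> and \<open>Hu\<close> on the
  diagonal; a boundary row is \<open>lb\<close> times a unit vector (\<open>residual_secant_family\<close>). These matrices form a compact convex
  family. Hyperplane separation shows that the family contains the generalized Jacobians of \<open>F\<close> and that the
  vectors \<open>2 A\<^sup>T F(u)\<close>, with \<open>A\<close> in the family, contain the Clarke gradient of the squared norm of \<open>F\<close>
  (\<open>generalized_jacobian_subset\<close>, \<open>clarke_gradient_norm_squared_subset\<close>). All claims thereby reduce to estimates that are
  uniform over the family.

  \<^bold>\<open>Maximum norm.\<close> A single positive vector \<open>w\<close>, geometric in one coordinate direction, satisfies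
  \<open>A w \<ge> 1\<close> for the whole family (\<open>barrier\<close>). The maximum principle then bounds \<open>x\<close> by the maximum of \<open>w\<close>
  times the maximum norm of \<open>A x\<close>, which is the second claim. It also gives a uniform lower bound on
  \<open>A\<close>: the map \<open>F\<close> is injective with closed range, hence bijective by invariance of domain, and a
  critical point, where \<open>A\<^sup>T F(u) = 0\<close>, must be a zero of \<open>F\<close>.

  \<^bold>\<open>Euclidean norm.\<close> On vectors that vanish at boundary nodes \<open>A\<close> is coercive with constant \<open>m\<close>: a discrete
  Poincare inequality with a parabolic weight controls the diffusion from below, and the transport terms are small
  perturbations (\<open>interior_coercive\<close>). The boundary part of \<open>x\<close> is explicit, and the largeness of \<open>lb\<close> dominates
  its influence on interior rows (\<open>l2_stability\<close>). Passing to the transpose yields the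
  Polyak-Lojasiewicz inequality; the Schur test bounds \<open>A\<close> from above and so its condition number.
\<close>

section \<open>Matrix estimates\<close>

lemma norm_squared_vec: "(norm (x :: real ^ 'n::finite))\<^sup>2 = (\<Sum>i\<in>UNIV. (x $ i)\<^sup>2)"
  by (simp add: power2_norm_eq_inner inner_vec_def power2_eq_square[of "_ $ _"])

lemma matrix_vector_mult_row: "((A :: real ^ 'n::finite ^ 'm::finite) *v x) $ i = A $ i \<bullet> x"
  by (simp add: matrix_vector_mult_def inner_vec_def)

text \<open>
  A matrix whose absolute row sums and column sums are at most \<open>M\<close> is the geometric mean of an
  \<open>\<ell>\<^sup>1\<close> and an \<open>\<ell>\<^sup>\<infinity>\<close> bound. The matrices of the scheme are sparse but not symmetric, and row and column
  sums are the quantities that can be read off from a stencil.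
\<close>

lemma schur_test:
  fixes A :: "real ^ 'n::finite ^ 'm::finite"
  assumes rows: "\<And>i. (\<Sum>j\<in>UNIV. \<bar>A $ i $ j\<bar>) \<le> M"
    and cols: "\<And>j. (\<Sum>i\<in>UNIV. \<bar>A $ i $ j\<bar>) \<le> M"
  shows "norm (A *v x) \<le> M * norm x"
proof -
  have M: "0 \<le> M"
    by (rule order_trans[OF sum_nonneg rows[of undefined]]) simp
  have row: "((A *v x) $ i)\<^sup>2 \<le> M * (\<Sum>j\<in>UNIV. \<bar>A $ i $ j\<bar> * (x $ j)\<^sup>2)" for i
  proof -
    have "\<bar>(A *v x) $ i\<bar> \<le> (\<Sum>j\<in>UNIV. sqrt \<bar>A $ i $ j\<bar> * (sqrt \<bar>A $ i $ j\<bar> * \<bar>x $ j\<bar>))"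
      unfolding matrix_vector_mult_def
      by (simp add: mult.assoc[symmetric] flip: abs_mult)
    then have "\<bar>(A *v x) $ i\<bar>\<^sup>2 \<le> (\<Sum>j\<in>UNIV. sqrt \<bar>A $ i $ j\<bar> * (sqrt \<bar>A $ i $ j\<bar> * \<bar>x $ j\<bar>))\<^sup>2"
      by (rule power_mono) simp
    also have "\<dots> \<le> (\<Sum>j\<in>UNIV. (sqrt \<bar>A $ i $ j\<bar>)\<^sup>2) * (\<Sum>j\<in>UNIV. (sqrt \<bar>A $ i $ j\<bar> * \<bar>x $ j\<bar>)\<^sup>2)"
      by (rule Cauchy_Schwarz_ineq_sum)
    also have "\<dots> = (\<Sum>j\<in>UNIV. \<bar>A $ i $ j\<bar>) * (\<Sum>j\<in>UNIV. \<bar>A $ i $ j\<bar> * (x $ j)\<^sup>2)"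
      by (simp add: power_mult_distrib)
    also have "\<dots> \<le> M * (\<Sum>j\<in>UNIV. \<bar>A $ i $ j\<bar> * (x $ j)\<^sup>2)"
      by (intro mult_right_mono rows sum_nonneg) simp
    finally show ?thesis by simp
  qed
  have "(norm (A *v x))\<^sup>2 \<le> (\<Sum>i\<in>UNIV. M * (\<Sum>j\<in>UNIV. \<bar>A $ i $ j\<bar> * (x $ j)\<^sup>2))"
    unfolding norm_squared_vec by (rule sum_mono) (rule row)
  also have "\<dots> = M * (\<Sum>j\<in>UNIV. (\<Sum>i\<in>UNIV. \<bar>A $ i $ j\<bar>) * (x $ j)\<^sup>2)"
    unfolding sum_distrib_left[symmetric] sum_distrib_right by (subst sum.swap) (rule refl)
  also have "\<dots> \<le> M * (\<Sum>j\<in>UNIV. M * (x $ j)\<^sup>2)"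
    by (intro mult_left_mono sum_mono mult_right_mono cols M) simp
  also have "\<dots> = (M * norm x)\<^sup>2"
    by (simp add: power_mult_distrib norm_squared_vec sum_distrib_left[symmetric] power2_eq_square[of M])
  finally show ?thesis
    by (rule power2_le_imp_le) (simp add: M)
qed

lemma infnorm_le_cart:
  fixes x :: "real ^ 'n::finite"
  assumes "\<And>i. \<bar>x $ i\<bar> \<le> b"
  shows "infnorm x \<le> b"
  unfolding infnorm_cart by (rule cSup_least) (use assms in auto)

text \<open>
  The maximum principle in quantitative form. At an index \<open>i\<close> maximizing \<open>\<bar>u $ i\<bar> / w $ i\<close>, with
  maximal quotient \<open>t\<close>, the vector \<open>t w \<mp> u\<close> is non-negative and vanishes at \<open>i\<close>. The sign of the
  off-diagonal entries therefore makes row \<open>i\<close> of \<open>A (t w \<mp> u)\<close> non-positive, and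
  \<open>1 \<le> A w\<close> turns this into a bound for \<open>t\<close>.
\<close>

lemma barrier_estimate:
  fixes A :: "real ^ 'n::finite ^ 'n"
  assumes offdiag: "\<And>i j. i \<noteq> j \<Longrightarrow> A $ i $ j \<le> 0"
    and w_pos: "\<And>i. 0 < w $ i" and w_le: "\<And>i. w $ i \<le> C"
    and Aw: "\<And>i. 1 \<le> (A *v w) $ i"
  shows "infnorm u \<le> C * infnorm (A *v u)"
proof -
  define q where "q j = \<bar>u $ j\<bar> / w $ j" for j
  obtain i where i: "\<And>j. q j \<le> q i"
  proof -
    have "Max (range q) \<in> range q" by (rule Max_in) auto
    then obtain i where "Max (range q) = q i" by blast
    then show thesis by (intro that[of i]) (metis Max_ge finite finite_imageI rangeI)
  qed
  define \<sigma> :: real where "\<sigma> = (if 0 \<le> u $ i then 1 else - 1)"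
  have \<sigma>: "\<sigma> * u $ i = \<bar>u $ i\<bar>" "\<And>x. \<sigma> * x \<le> \<bar>x\<bar>"
    by (auto simp: \<sigma>_def)
  have q_nonneg: "0 \<le> q i" using w_pos[of i] by (simp add: q_def)
  define z where "z = q i *\<^sub>R w - \<sigma> *\<^sub>R u"
  have u_le: "\<bar>u $ j\<bar> \<le> q i * w $ j" for j
    using i[of j] w_pos[of j] by (simp add: q_def pos_divide_le_eq)
  have z_nonneg: "0 \<le> z $ j" for j
    using u_le[of j] \<sigma>(2)[of "u $ j"] by (simp add: z_def)
  have z_i: "z $ i = 0"
    using w_pos[of i] by (simp add: z_def \<sigma> q_def)
  have "(A *v z) $ i = (\<Sum>j\<in>UNIV. A $ i $ j * z $ j)"
    by (simp add: matrix_vector_mult_def)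
  also have "\<dots> \<le> 0"
  proof (rule sum_nonpos)
    fix j
    show "A $ i $ j * z $ j \<le> 0"
      using offdiag[of i j] z_nonneg[of j] z_i by (cases "i = j") (auto intro: mult_nonpos_nonneg)
  qed
  also have "(A *v z) $ i = q i * (A *v w) $ i - \<sigma> * (A *v u) $ i"
    by (simp add: z_def matrix_vector_mult_diff_distrib matrix_vector_mult_scaleR)
  finally have "q i * (A *v w) $ i \<le> \<sigma> * (A *v u) $ i" by simp
  moreover have "q i * 1 \<le> q i * (A *v w) $ i"
    by (rule mult_left_mono[OF Aw q_nonneg])
  ultimately have q_le: "q i \<le> infnorm (A *v u)"
    using \<sigma>(2)[of "(A *v u) $ i"] component_le_infnorm_cart[of "A *v u" i] by linarith
  show ?thesis
  proof (rule infnorm_le_cart)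
    fix j
    have "\<bar>u $ j\<bar> \<le> q i * w $ j" by (rule u_le)
    also have "\<dots> \<le> q i * C" by (rule mult_left_mono[OF w_le q_nonneg])
    also have "\<dots> \<le> infnorm (A *v u) * C"
      using w_pos[of j] w_le[of j] by (intro mult_right_mono q_le) linarith
    finally show "\<bar>u $ j\<bar> \<le> C * infnorm (A *v u)" by (simp add: mult.commute)
  qed
qed

text \<open>
  A matrix and its transpose have inverses of equal Euclidean norm. Writing \<open>y = A x\<close>, the estimate
  is \<open>\<bar>y\<bar>\<^sup>2 = \<langle>A\<^sup>T y, x\<rangle> \<le> \<bar>A\<^sup>T y\<bar> c \<bar>y\<bar>\<close>. It converts stability of the scheme into a lower bound for the
  gradient \<open>2 A\<^sup>T F(u)\<close> of the least-squares functional.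
\<close>

lemma transpose_lower_bound:
  fixes A :: "real ^ 'n::finite ^ 'n"
  assumes lower: "\<And>x. norm x \<le> c * norm (A *v x)" and c: "0 \<le> c"
  shows "norm y \<le> c * norm (y v* A)"
proof -
  have "inj ((*v) A)"
  proof (rule injI)
    fix a b assume "A *v a = A *v b"
    then show "a = b"
      using lower[of "a - b"] by (simp add: matrix_vector_mult_diff_distrib)
  qed
  then have "surj ((*v) A)"
    by (intro linear_injective_imp_surjective) auto
  then obtain x where x: "y = A *v x" by (metis surjD)
  have "(norm y)\<^sup>2 = (y v* A) \<bullet> x"
    unfolding power2_norm_eq_inner by (simp add: dot_lmul_matrix x[symmetric])
  also have "\<dots> \<le> norm (y v* A) * norm x" by (rule norm_cauchy_schwarz)
  also have "\<dots> \<le> norm (y v* A) * (c * norm y)"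
    unfolding x by (intro mult_left_mono lower) simp
  finally have "norm y * norm y \<le> (c * norm (y v* A)) * norm y"
    by (simp add: power2_eq_square mult_ac)
  then show ?thesis
    using c by (cases "y = 0") (auto simp: mult_le_cancel_right)
qed

lemma condition_number_le:
  fixes A :: "real ^ 'n::finite ^ 'n"
  assumes lower: "\<And>x. norm x \<le> s * norm (A *v x)" and upper: "\<And>x. norm (A *v x) \<le> M * norm x"
    and s: "0 \<le> s" and M: "0 \<le> M"
  shows "invertible A" "condition_number A \<le> s * M"
proof -
  have "inj ((*v) A)"
  proof (rule injI)
    fix a b assume "A *v a = A *v b"
    then show "a = b"
      using lower[of "a - b"] by (simp add: matrix_vector_mult_diff_distrib)
  qed
  then show inv: "invertible A"
    by (simp add: invertible_left_inverse matrix_left_invertible_injective)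
  have "op_norm2 A \<le> M"
    unfolding op_norm2_def by (rule onorm_bound[OF M upper])
  moreover have "op_norm2 (matrix_inv A) \<le> s"
    unfolding op_norm2_def
  proof (rule onorm_bound[OF s])
    fix y
    have "A ** matrix_inv A = mat 1"
      using someI_ex[OF inv[unfolded invertible_def]] by (simp add: matrix_inv_def)
    then have "A *v (matrix_inv A *v y) = y"
      by (simp add: matrix_vector_mul_assoc)
    then show "norm (matrix_inv A *v y) \<le> s * norm y" using lower[of "matrix_inv A *v y"] by simp
  qed
  moreover have "0 \<le> op_norm2 (matrix_inv A)"
    unfolding op_norm2_def by (intro onorm_pos_le) auto
  ultimately have "condition_number A \<le> M * s"
    unfolding condition_number_def using M by (intro mult_mono) auto
  then show "condition_number A \<le> s * M" by (simp add: mult.commute)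
qed

section \<open>Generalized differentials through secant matrices\<close>

text \<open>
  A strictly separating direction \<open>h\<close> would contradict the hypothesis for that \<open>h\<close>. The lemma allows
  the matrix found in a directional limit to depend on the direction, which is all that
  difference quotients of a non-smooth map provide.
\<close>

lemma closed_convex_by_support:
  fixes S :: "'a::euclidean_space set"
  assumes "convex S" "closed S" and h: "\<And>h. \<exists>a\<in>S. a \<bullet> h = w \<bullet> h"
  shows "w \<in> S"
proof (rule ccontr)
  assume "w \<notin> S"
  then obtain a b where "a \<bullet> w < b" "\<forall>x\<in>S. b < a \<bullet> x"
    using separating_hyperplane_closed_point[OF assms(1,2)] by blast
  then show False using h[of a] by (auto simp: inner_commute)
qed

lemma GDERIV_difference_quotient:
  assumes f: "GDERIV f v :> w" and s: "s \<longlonglongrightarrow> 0" "\<And>n. s n \<noteq> (0::real)"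
  shows "(\<lambda>n. (f (v + s n *\<^sub>R h) - f v) / s n) \<longlonglongrightarrow> w \<bullet> h"
proof -
  have "(f has_derivative (\<lambda>k. k \<bullet> w)) (at (v + 0 *\<^sub>R h))"
    using f by (simp add: gderiv_def)
  moreover have "((\<lambda>t::real. v + t *\<^sub>R h) has_derivative (\<lambda>t. t *\<^sub>R h)) (at 0)"
    by (auto intro!: derivative_eq_intros)
  ultimately have "((\<lambda>t. f (v + t *\<^sub>R h)) has_derivative (\<lambda>t. (t *\<^sub>R h) \<bullet> w)) (at (0::real))"
    using has_derivative_compose[of "\<lambda>t. v + t *\<^sub>R h" _ 0 UNIV f] by blast
  moreover have "(\<lambda>t::real. (t *\<^sub>R h) \<bullet> w) = (*) (w \<bullet> h)"
    by (auto simp: inner_commute)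
  ultimately have "((\<lambda>t. f (v + t *\<^sub>R h)) has_field_derivative (w \<bullet> h)) (at (0::real))"
    by (simp add: has_field_derivative_def)
  then have "((\<lambda>t. (f (v + t *\<^sub>R h) - f v) / t) \<longlongrightarrow> w \<bullet> h) (at (0::real))"
    by (simp add: DERIV_def)
  moreover have "filterlim s (at 0) sequentially"
    using s by (simp add: filterlim_at)
  ultimately show ?thesis by (rule filterlim_compose)
qed

text \<open>
  The set of matrices is a product of sets of rows, so that a matrix may be tested for membership row by
  row; separation in the space of all matrices would need directions that are not of rank one.
\<close>

definition row_family :: "('m::finite \<Rightarrow> (real ^ 'n::finite) set) \<Rightarrow> (real ^ 'n ^ 'm) set" where
  "row_family S = {A. \<forall>i. A $ i \<in> S i}"

lemma compact_row_family:
  assumes "\<And>i. compact (S i)"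
  shows "compact (row_family S)"
proof -
  have "row_family S = (\<Inter>i. (\<lambda>A. A $ i) -` S i)"
    by (auto simp: row_family_def)
  moreover have "closed ((\<lambda>A::real^'b^'a. A $ i) -` S i)" for i
    by (rule closed_vimage) (auto intro!: compact_imp_closed assms continuous_intros)
  ultimately have "closed (row_family S)" by auto
  moreover have "bounded (row_family S)"
  proof -
    have "\<exists>b. \<forall>x\<in>S i. norm x \<le> b" for i
      using compact_imp_bounded[OF assms] by (simp add: bounded_iff)
    then obtain b where b: "\<And>i x. x \<in> S i \<Longrightarrow> norm x \<le> b i" by metis
    show ?thesis
    proof (rule boundedI)
      fix A assume A: "A \<in> row_family S"
      have "norm A \<le> (\<Sum>i\<in>UNIV. norm (A $ i))"
        unfolding norm_vec_def[of A] by (rule L2_set_le_sum) simp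
      also have "\<dots> \<le> sum b UNIV"
        using A by (intro sum_mono b) (auto simp: row_family_def)
      finally show "norm A \<le> sum b UNIV" .
    qed
  qed
  ultimately show ?thesis by (simp add: compact_eq_bounded_closed)
qed

lemma convex_row_family:
  assumes "\<And>i. convex (S i)"
  shows "convex (row_family S)"
  using assms by (auto simp: row_family_def convex_def)

text \<open>
  The mean value theorem, turned into a definition: every increment of \<open>F\<close> is represented by some
  matrix of one compact convex family.
\<close>

definition secant_family ::
    "(real ^ 'n::finite \<Rightarrow> real ^ 'm::finite) \<Rightarrow> ('m \<Rightarrow> (real ^ 'n) set) \<Rightarrow> bool" where
  "secant_family F S \<longleftrightarrow> (\<forall>i. compact (S i) \<and> convex (S i)) \<and>
     (\<forall>u v. \<exists>A\<in>row_family S. F u - F v = A *v (u - v))"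

text \<open>
  Secant matrices along a segment shrinking to \<open>v\<close> accumulate in the compact family, and
  the difference quotients follow them.
\<close>

lemma secant_directional_limit:
  assumes F: "secant_family F S"
  obtains A s where "A \<in> row_family S" "s \<longlonglongrightarrow> 0" "\<And>n. 0 < (s n :: real)"
    "(\<lambda>n. (F (v + s n *\<^sub>R h) - F v) /\<^sub>R s n) \<longlonglongrightarrow> A *v h"
proof -
  define t :: "nat \<Rightarrow> real" where "t n = 1 / real (Suc n)" for n
  have t: "0 < t n" for n by (simp add: t_def)
  have t0: "t \<longlonglongrightarrow> 0"
    using LIMSEQ_inverse_real_of_nat unfolding t_def inverse_eq_divide .
  have "\<forall>n. \<exists>A\<in>row_family S. F (v + t n *\<^sub>R h) - F v = A *v (t n *\<^sub>R h)"
    using F unfolding secant_family_def by (metis add_diff_cancel_left')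
  then obtain As where As: "\<And>n. As n \<in> row_family S"
    "\<And>n. F (v + t n *\<^sub>R h) - F v = As n *v (t n *\<^sub>R h)" by metis
  have "compact (row_family S)"
    using F by (intro compact_row_family) (simp add: secant_family_def)
  then obtain A r where A: "A \<in> row_family S" and r: "strict_mono r" "(As \<circ> r) \<longlonglongrightarrow> A"
    using As(1) unfolding compact_def by meson
  have "(\<lambda>n. (As \<circ> r) n *v h) \<longlonglongrightarrow> A *v h"
    unfolding matrix_vector_mult_def
    by (intro vec_tendstoI) (auto intro!: tendsto_intros r(2)[unfolded o_def] simp: o_def)
  moreover have "(F (v + (t \<circ> r) n *\<^sub>R h) - F v) /\<^sub>R (t \<circ> r) n = (As \<circ> r) n *v h" for n
    using t[of "r n"] by (simp add: As matrix_vector_mult_scaleR)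
  ultimately show thesis
    using A LIMSEQ_subseq_LIMSEQ[OF t0 r(1)] t by (intro that[of A "t \<circ> r"]) auto
qed

lemma lipschitz_secant_family:
  fixes F :: "real ^ 'n::finite \<Rightarrow> real ^ 'm::finite"
  assumes F: "secant_family F S"
  obtains K where "0 \<le> K" "\<And>u v. norm (F u - F v) \<le> K * norm (u - v)"
proof -
  have "compact (row_family S)"
    using F by (intro compact_row_family) (simp add: secant_family_def)
  then obtain b where b: "0 < b" "\<And>A. A \<in> row_family S \<Longrightarrow> norm A \<le> b"
    using compact_imp_bounded[of "row_family S"] unfolding bounded_pos by blast
  have "norm (F u - F v) \<le> b * real CARD('m) * norm (u - v)" for u v
  proof -
    obtain A where A: "A \<in> row_family S" "F u - F v = A *v (u - v)"
      using F unfolding secant_family_def by blast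
    have "norm (A *v (u - v)) \<le> (\<Sum>i\<in>UNIV. norm ((A *v (u - v)) $ i))"
      unfolding norm_vec_def[of "A *v (u - v)"] by (rule L2_set_le_sum) simp
    also have "\<dots> \<le> (\<Sum>i\<in>(UNIV::'m set). b * norm (u - v))"
    proof (rule sum_mono)
      fix i
      have "norm ((A *v (u - v)) $ i) \<le> norm (A $ i) * norm (u - v)"
        by (simp add: matrix_vector_mult_row Cauchy_Schwarz_ineq2)
      also have "\<dots> \<le> b * norm (u - v)"
        using Finite_Cartesian_Product.norm_nth_le[of A i] b(2)[OF A(1)] by (intro mult_right_mono) auto
      finally show "norm ((A *v (u - v)) $ i) \<le> b * norm (u - v)" .
    qed
    finally show ?thesis by (simp add: A mult_ac)
  qed
  then show thesis using b(1) by (intro that[of "b * real CARD('m)"]) auto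
qed

lemma continuous_secant_family:
  assumes F: "secant_family F S"
  shows "continuous_on UNIV F"
proof -
  obtain K where "0 \<le> K" "\<And>u v. norm (F u - F v) \<le> K * norm (u - v)"
    using lipschitz_secant_family[OF F] by metis
  then have "K-lipschitz_on UNIV F" by (intro lipschitz_onI) (auto simp: dist_norm)
  then show ?thesis by (rule lipschitz_on_continuous_on)
qed

text \<open>
  At a differentiability point, each row of the Jacobian agrees in every direction with a row of
  some member of the family, hence lies in the closed convex set of admissible rows. Limits and convex
  hulls do not leave a closed convex set.
\<close>

lemma generalized_jacobian_subset:
  assumes F: "secant_family F S"
  shows "generalized_jacobian F u \<subseteq> row_family S"
  unfolding generalized_jacobian_def
proof (rule hull_minimal)
  have S: "convex (S i)" "compact (S i)" "closed (S i)" for i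
    using F by (auto simp: secant_family_def compact_imp_closed)
  show "convex (row_family S)" by (rule convex_row_family) (rule S)
  have jac: "jacobian F (at v) \<in> row_family S" if "F differentiable (at v)" for v
  proof -
    let ?D = "jacobian F (at v)"
    have D: "(F has_derivative (*v) ?D) (at v)"
      using that by (simp add: jacobian_works)
    have "?D $ i \<in> S i" for i
    proof (rule closed_convex_by_support[OF S(1,3)])
      fix h
      obtain A s where A: "A \<in> row_family S" and s: "s \<longlonglongrightarrow> 0" "\<And>n. 0 < (s n :: real)"
        and lim: "(\<lambda>n. (F (v + s n *\<^sub>R h) - F v) /\<^sub>R s n) \<longlonglongrightarrow> A *v h"
        using secant_directional_limit[OF F] by blast
      have "GDERIV (\<lambda>u. F u $ i) v :> ?D $ i"
        unfolding gderiv_def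
        by (rule has_derivative_eq_rhs[OF bounded_linear.has_derivative[OF bounded_linear_vec_nth D]])
           (simp add: matrix_vector_mult_row inner_commute fun_eq_iff)
      then have "(\<lambda>n. (F (v + s n *\<^sub>R h) $ i - F v $ i) / s n) \<longlonglongrightarrow> ?D $ i \<bullet> h"
        using s by (intro GDERIV_difference_quotient) (auto simp: less_imp_neq[symmetric])
      moreover have "(\<lambda>n. (F (v + s n *\<^sub>R h) $ i - F v $ i) / s n) \<longlonglongrightarrow> A $ i \<bullet> h"
        using tendsto_vec_nth[OF lim, of i] by (simp add: matrix_vector_mult_row divide_inverse mult.commute)
      ultimately have "A $ i \<bullet> h = ?D $ i \<bullet> h"
        by (rule LIMSEQ_unique[rotated])
      then show "\<exists>a\<in>S i. a \<bullet> h = ?D $ i \<bullet> h"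
        using A by (auto simp: row_family_def)
    qed
    then show ?thesis by (simp add: row_family_def)
  qed
  have "closed (row_family S)" by (intro compact_imp_closed compact_row_family S)
  then show "{A. \<exists>us. (\<forall>n. F differentiable at (us n)) \<and> us \<longlonglongrightarrow> u \<and>
      (\<lambda>n. jacobian F (at (us n))) \<longlonglongrightarrow> A} \<subseteq> row_family S"
    using jac closed_sequentially[of "row_family S"] by fast
qed

lemma linear_vector_matrix_mult: "linear (\<lambda>A :: real ^ 'n::finite ^ 'm::finite. x v* A)"
  by (rule linearI)
     (simp_all add: vec_eq_iff vector_matrix_mult_def distrib_left sum.distrib sum_distrib_left mult.left_commute)

text \<open>
  A chain rule that avoids Rademacher's theorem. The function \<open>\<bar>F\<bar>\<^sup>2\<close> may be differentiable where \<open>F\<close> is not, so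
  its gradient cannot be computed from a Jacobian of \<open>F\<close>. Its directional derivatives are however of
  the form \<open>2 \<langle>F(v), A h\<rangle>\<close> with \<open>A\<close> in the family depending on \<open>h\<close>, and separation from the compact convex set
  of the vectors \<open>2 A\<^sup>T F(v)\<close> removes this dependence.
\<close>

lemma clarke_gradient_norm_squared_subset:
  assumes F: "secant_family F S"
  shows "clarke_gradient (\<lambda>u. (norm (F u))\<^sup>2) u \<subseteq> (\<lambda>A. 2 *\<^sub>R (F u v* A)) ` row_family S"
  unfolding clarke_gradient_def
proof (rule hull_minimal)
  have conv: "convex (row_family S)" and comp: "compact (row_family S)"
    using F by (simp_all add: secant_family_def convex_row_family compact_row_family)
  have lin: "linear (\<lambda>A. 2 *\<^sub>R (F v v* A))" for v
    by (intro linear_compose_scale_right linear_vector_matrix_mult)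
  have image: "convex ((\<lambda>A. 2 *\<^sub>R (F v v* A)) ` row_family S)"
    "closed ((\<lambda>A. 2 *\<^sub>R (F v v* A)) ` row_family S)" for v
    using convex_linear_image[OF lin conv]
      compact_imp_closed[OF compact_continuous_image[OF
          linear_continuous_on[OF lin[unfolded linear_conv_bounded_linear]] comp]] .
  show "convex ((\<lambda>A. 2 *\<^sub>R (F u v* A)) ` row_family S)" by (rule image)
  have grad: "w \<in> (\<lambda>A. 2 *\<^sub>R (F v v* A)) ` row_family S"
    if w: "GDERIV (\<lambda>u. (norm (F u))\<^sup>2) v :> w" for v w
  proof (rule closed_convex_by_support[OF image])
    fix h
    obtain A s where A: "A \<in> row_family S" and s: "s \<longlonglongrightarrow> 0" "\<And>n. 0 < (s n :: real)"
      and lim: "(\<lambda>n. (F (v + s n *\<^sub>R h) - F v) /\<^sub>R s n) \<longlonglongrightarrow> A *v h"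
      using secant_directional_limit[OF F] by blast
    have "(\<lambda>n. v + s n *\<^sub>R h) \<longlonglongrightarrow> v + 0 *\<^sub>R h" by (intro tendsto_intros s)
    then have "(\<lambda>n. F (v + s n *\<^sub>R h)) \<longlonglongrightarrow> F v"
      using continuous_on_tendsto_compose[OF continuous_secant_family[OF F]] by fastforce
    then have "(\<lambda>n. (F (v + s n *\<^sub>R h) + F v) \<bullet> ((F (v + s n *\<^sub>R h) - F v) /\<^sub>R s n))
        \<longlonglongrightarrow> (F v + F v) \<bullet> (A *v h)"
      by (intro tendsto_intros lim)
    moreover have "(a + b) \<bullet> ((a - b) /\<^sub>R c) = ((norm a)\<^sup>2 - (norm b)\<^sup>2) / c"
      for a b :: "real ^ 'b" and c :: real
      by (simp add: power2_norm_eq_inner inner_add_left inner_diff_right inner_commute[of b a] divide_inverse)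
    ultimately have "(\<lambda>n. ((norm (F (v + s n *\<^sub>R h)))\<^sup>2 - (norm (F v))\<^sup>2) / s n)
        \<longlonglongrightarrow> (F v + F v) \<bullet> (A *v h)"
      by (simp only:)
    moreover have "(F v + F v) \<bullet> (A *v h) = (2 *\<^sub>R (F v v* A)) \<bullet> h"
      by (simp only: dot_lmul_matrix inner_add_left inner_scaleR_left mult_2)
    ultimately have "(\<lambda>n. ((norm (F (v + s n *\<^sub>R h)))\<^sup>2 - (norm (F v))\<^sup>2) / s n)
        \<longlonglongrightarrow> (2 *\<^sub>R (F v v* A)) \<bullet> h"
      by (simp only:)
    moreover have "(\<lambda>n. ((norm (F (v + s n *\<^sub>R h)))\<^sup>2 - (norm (F v))\<^sup>2) / s n) \<longlonglongrightarrow> w \<bullet> h"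
      using s by (intro GDERIV_difference_quotient[OF w]) (auto simp: less_imp_neq[symmetric])
    ultimately have "(2 *\<^sub>R (F v v* A)) \<bullet> h = w \<bullet> h"
      by (rule LIMSEQ_unique)
    then show "\<exists>a\<in>(\<lambda>A. 2 *\<^sub>R (F v v* A)) ` row_family S. a \<bullet> h = w \<bullet> h"
      using A by blast
  qed
  show "{w. \<exists>us ws. (\<forall>n. GDERIV (\<lambda>u. (norm (F u))\<^sup>2) (us n) :> ws n) \<and> us \<longlonglongrightarrow> u \<and> ws \<longlonglongrightarrow> w}
      \<subseteq> (\<lambda>A. 2 *\<^sub>R (F u v* A)) ` row_family S"
  proof clarify
    fix w us ws
    assume G: "\<forall>n. GDERIV (\<lambda>u. (norm (F u))\<^sup>2) (us n) :> ws n"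
      and us: "us \<longlonglongrightarrow> u" and ws: "ws \<longlonglongrightarrow> w"
    have "\<forall>n. \<exists>A\<in>row_family S. ws n = 2 *\<^sub>R (F (us n) v* A)"
      using G grad by blast
    then obtain As where As: "\<And>n. As n \<in> row_family S" "\<And>n. ws n = 2 *\<^sub>R (F (us n) v* As n)"
      by metis
    obtain A r where A: "A \<in> row_family S" and r: "strict_mono r" "(As \<circ> r) \<longlonglongrightarrow> A"
      using comp As(1) unfolding compact_def by meson
    have "(\<lambda>n. F (us n)) \<longlonglongrightarrow> F u"
      using continuous_on_tendsto_compose[OF continuous_secant_family[OF F] us] by simp
    then have "(\<lambda>n. F (us (r n))) \<longlonglongrightarrow> F u"
      using LIMSEQ_subseq_LIMSEQ[OF _ r(1)] by (fastforce simp: o_def)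
    then have "(\<lambda>n. 2 *\<^sub>R (F (us (r n)) v* (As \<circ> r) n)) \<longlonglongrightarrow> 2 *\<^sub>R (F u v* A)"
      unfolding vector_matrix_mult_def
      by (intro vec_tendstoI tendsto_scaleR tendsto_const)
         (auto intro!: tendsto_intros r(2)[unfolded o_def] simp: o_def)
    then have "(ws \<circ> r) \<longlonglongrightarrow> 2 *\<^sub>R (F u v* A)" by (simp add: As o_def)
    then have "w = 2 *\<^sub>R (F u v* A)"
      by (rule LIMSEQ_unique[OF LIMSEQ_subseq_LIMSEQ[OF ws r(1)]])
    then show "w \<in> (\<lambda>A. 2 *\<^sub>R (F u v* A)) ` row_family S" using A by blast
  qed
qed

text \<open>
  The lower bound makes \<open>F\<close> injective with closed range; the range is also open by invariance
  of domain.
\<close>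

lemma secant_family_surj:
  fixes F :: "real ^ 'n::finite \<Rightarrow> real ^ 'n"
  assumes F: "secant_family F S" and C: "0 \<le> C"
    and lower: "\<And>u v. norm (u - v) \<le> C * norm (F u - F v)"
  shows "surj F"
proof -
  have cont: "continuous_on UNIV F" by (rule continuous_secant_family[OF F])
  have inj: "inj F"
  proof (rule injI)
    fix u v assume "F u = F v"
    then show "u = v" using lower[of u v] by simp
  qed
  have "open (range F)"
    by (rule invariance_of_domain[OF cont open_UNIV inj])
  moreover have "closed (range F)"
  proof -
    have limit: "l \<in> range F" if x: "\<forall>n. x n \<in> range F" "x \<longlonglongrightarrow> l" for x l
    proof -
      obtain us where us: "\<And>n. x n = F (us n)" 
        using x(1) unfolding image_iff by metis
      have "Cauchy us"
      proof (rule metric_CauchyI)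
        fix e :: real assume e: "0 < e"
        then have e': "0 < e / (C + 1)" using C by simp
        obtain M where M: "\<And>m n. M \<le> m \<Longrightarrow> M \<le> n \<Longrightarrow> dist (x m) (x n) < e / (C + 1)"
          using metric_CauchyD[OF LIMSEQ_imp_Cauchy[OF x(2)] e'] by blast
        have "dist (us m) (us n) < e" if "M \<le> m" "M \<le> n" for m n
        proof -
          have "dist (us m) (us n) \<le> C * dist (x m) (x n)"
            using lower by (simp add: dist_norm us)
          also have "\<dots> \<le> (C + 1) * dist (x m) (x n)"
            by (intro mult_right_mono) auto
          also have "\<dots> < (C + 1) * (e / (C + 1))"
            using M[OF that] C by (intro mult_strict_left_mono) auto
          also have "\<dots> = e" using C by simp
          finally show ?thesis .
        qed
        then show "\<exists>M. \<forall>m\<ge>M. \<forall>n\<ge>M. dist (us m) (us n) < e" by blast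
      qed
      then obtain u where "us \<longlonglongrightarrow> u" 
        using Cauchy_convergent[of us] unfolding convergent_def by blast
      then have "x \<longlonglongrightarrow> F u"
        using continuous_on_tendsto_compose[OF cont, of us u] by (simp add: us[abs_def])
      then have "l = F u" by (rule LIMSEQ_unique[OF x(2)])
      then show ?thesis by blast
    qed
    show ?thesis
      unfolding closed_sequential_limits by (intro allI impI, elim conjE) (rule limit)
  qed
  ultimately show ?thesis
    using clopen[of "range F"] by auto
qed

text \<open>
  Near a zero of the Lipschitz map \<open>F\<close> the square of the norm grows at most quadratically, so it is
  differentiable there even if \<open>F\<close> is not.
\<close>

lemma GDERIV_norm_squared_at_zero:
  fixes F :: "'a::real_inner \<Rightarrow> 'b::real_normed_vector"
  assumes zero: "F u = 0" and lip: "\<And>v. norm (F v - F u) \<le> K * norm (v - u)"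
  shows "GDERIV (\<lambda>v. (norm (F v))\<^sup>2) u :> 0"
  unfolding gderiv_def has_derivative_iff_norm
proof
  have lim: "((\<lambda>v. K\<^sup>2 * norm (v - u)) \<longlongrightarrow> 0) (at u)"
    by (auto intro!: tendsto_eq_intros)
  have "norm (norm ((norm (F v))\<^sup>2 - (norm (F u))\<^sup>2 - (v - u) \<bullet> 0) / norm (v - u))
      \<le> K\<^sup>2 * norm (v - u)" for v
  proof -
    have "(norm (F v))\<^sup>2 \<le> (K * norm (v - u))\<^sup>2"
      using lip[of v] zero by (intro power_mono) auto
    then show ?thesis
      by (cases "v = u") (simp_all add: zero pos_divide_le_eq power_mult_distrib power2_eq_square mult_ac)
  qed
  then show "((\<lambda>v. norm ((norm (F v))\<^sup>2 - (norm (F u))\<^sup>2 - (v - u) \<bullet> 0) / norm (v - u)) \<longlongrightarrow> 0) (at u)"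
    by (intro Lim_null_comparison[OF always_eventually lim] allI)
qed simp

lemma zero_in_clarke_gradient_at_zero:
  assumes F: "secant_family F S" and zero: "F u = 0"
  shows "0 \<in> clarke_gradient (\<lambda>v. (norm (F v))\<^sup>2) u"
proof -
  obtain K where "\<And>u v. norm (F u - F v) \<le> K * norm (u - v)"
    using lipschitz_secant_family[OF F] by metis
  then have "GDERIV (\<lambda>v. (norm (F v))\<^sup>2) u :> 0"
    by (intro GDERIV_norm_squared_at_zero zero)
  then show ?thesis
    unfolding clarke_gradient_def
    by (intro hull_inc CollectI exI[of _ "\<lambda>_. u"] exI[of _ "\<lambda>_. 0"]) auto
qed

section \<open>Secants of a monotone Lipschitz function\<close>

text \<open>
  Let \<open>\<delta>\<close> be the largest entry of \<open>p - q\<close>, at index \<open>k\<close>. Replacing \<open>p\<close> by \<open>max p q\<close> can only increase \<open>G\<close>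
  and moves \<open>q\<close> by at most \<open>\<delta>\<close>, so the increment is at most \<open>K \<delta>\<close>. It can thus be charged entirely to the
  coordinate \<open>k\<close>: the slope vector has the single entry \<open>(G p - G q) / \<delta>\<close>.
\<close>

lemma monotone_lipschitz_secant_le:
  fixes G :: "real ^ 'k::finite \<Rightarrow> real"
  assumes lip: "\<And>p q. \<bar>G p - G q\<bar> \<le> K * infnorm (p - q)" and K: "0 \<le> K"
    and mono: "\<And>p q. p \<le> q \<Longrightarrow> G p \<le> G q" and le: "G q \<le> G p"
  shows "\<exists>c. (\<forall>k. 0 \<le> c $ k) \<and> (\<Sum>k\<in>UNIV. c $ k) \<le> K \<and> G p - G q = c \<bullet> (p - q)"
proof -
  obtain k where k: "\<And>j. (p - q) $ j \<le> (p - q) $ k"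
  proof -
    have "Max (range (($) (p - q))) \<in> range (($) (p - q))" by (rule Max_in) auto
    then obtain k where "Max (range (($) (p - q))) = (p - q) $ k" by blast
    then show thesis by (intro that[of k]) (metis Max_ge finite finite_imageI rangeI)
  qed
  define \<delta> where "\<delta> = (p - q) $ k"
  show ?thesis
  proof (cases "\<delta> \<le> 0")
    case True
    then have "p \<le> q" unfolding less_eq_vec_def \<delta>_def
      using k by (metis diff_le_0_iff_le order_trans vector_minus_component)
    then have "G p - G q = 0 \<bullet> (p - q)" using mono le by fastforce
    then show ?thesis using K by (intro exI[of _ 0]) auto
  next
    case False
    define r where "r = (\<chi> j. max (p $ j) (q $ j))"
    have "infnorm (r - q) \<le> \<delta>"
    proof (rule infnorm_le_cart)
      fix j show "\<bar>(r - q) $ j\<bar> \<le> \<delta>"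
        using k[of j] False by (auto simp: r_def \<delta>_def max_def abs_if)
    qed
    then have "K * infnorm (r - q) \<le> K * \<delta>" using K by (rule mult_left_mono)
    then have "G r - G q \<le> K * \<delta>" using lip[of r q] by linarith
    moreover have "G p \<le> G r" by (rule mono) (simp add: less_eq_vec_def r_def)
    ultimately have "G p - G q \<le> K * \<delta>" by simp
    then have "(G p - G q) / \<delta> \<le> K" using False by (simp add: pos_divide_le_eq)
    moreover have "axis k ((G p - G q) / \<delta>) \<bullet> (p - q) = (G p - G q) / \<delta> * \<delta>"
      by (simp add: inner_axis' \<delta>_def)
    moreover have "(\<Sum>j\<in>UNIV. axis k ((G p - G q) / \<delta>) $ j) = (G p - G q) / \<delta>"
      by (simp add: axis_def)
    ultimately show ?thesis
      using False le by (intro exI[of _ "axis k ((G p - G q) / \<delta>)"]) (auto simp: axis_def)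
  qed
qed

text \<open>
  The slope is bounded in the \<open>\<ell>\<^sup>1\<close> norm, which is dual to the maximum norm of the Lipschitz
  condition.
\<close>

lemma monotone_lipschitz_secant:
  fixes G :: "real ^ 'k::finite \<Rightarrow> real"
  assumes lip: "\<And>p q. \<bar>G p - G q\<bar> \<le> K * infnorm (p - q)" and K: "0 \<le> K"
    and mono: "\<And>p q. p \<le> q \<Longrightarrow> G p \<le> G q"
  obtains c where "\<And>k. 0 \<le> c $ k" "(\<Sum>k\<in>UNIV. c $ k) \<le> K" "G p - G q = c \<bullet> (p - q)"
proof (cases "G q \<le> G p")
  case True
  then show thesis
    using monotone_lipschitz_secant_le[OF lip K mono] that by blast
next
  case False
  then obtain c where "\<And>k. 0 \<le> c $ k" "(\<Sum>k\<in>UNIV. c $ k) \<le> K" "G q - G p = c \<bullet> (q - p)"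
    using monotone_lipschitz_secant_le[OF lip K mono, of p q] by auto
  then show thesis by (intro that[of c]) (auto simp: inner_diff_right)
qed

section \<open>The grid and the matrices of the scheme\<close>

lemma infnorm_le_sup_diameter:
  fixes \<Omega> :: "(real ^ 'd::finite) set"
  assumes "bounded \<Omega>" and x: "x \<in> closure \<Omega>" and y: "y \<in> closure \<Omega>"
  shows "infnorm (x - y) \<le> sup_diameter \<Omega>"
proof -
  obtain b where b: "\<And>x. x \<in> \<Omega> \<Longrightarrow> norm x \<le> b"
    using assms(1) unfolding bounded_iff by blast
  have "bdd_above ((\<lambda>(x, y). infnorm (x - y)) ` (\<Omega> \<times> \<Omega>))"
  proof (rule bdd_aboveI)
    fix r assume "r \<in> (\<lambda>(x, y). infnorm (x - y)) ` (\<Omega> \<times> \<Omega>)"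
    then obtain x y where xy: "x \<in> \<Omega>" "y \<in> \<Omega>" "r = infnorm (x - y)" by auto
    have "r \<le> norm (x - y)" unfolding xy by (rule infnorm_le_norm)
    then show "r \<le> b + b" using norm_triangle_ineq4[of x y] b[OF xy(1)] b[OF xy(2)] by linarith
  qed
  then have le: "infnorm (x - y) \<le> sup_diameter \<Omega>" if "x \<in> \<Omega>" "y \<in> \<Omega>" for x y
    unfolding sup_diameter_def using that by (intro cSUP_upper2[where x="(x, y)"]) auto
  obtain xs ys where "\<And>n. xs n \<in> \<Omega>" "xs \<longlonglongrightarrow> x" "\<And>n. ys n \<in> \<Omega>" "ys \<longlonglongrightarrow> y"
    using x y unfolding closure_sequential by blast
  then show ?thesis
    by (intro LIMSEQ_le_const2[of "\<lambda>n. infnorm (xs n - ys n)"])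
       (auto intro!: tendsto_infnorm tendsto_diff le)
qed

lemma sum_directions:
  "(\<Sum>k\<in>(UNIV :: ('d::finite \<times> bool) set). f k) = (\<Sum>l\<in>UNIV. f (l, True) + f (l, False))"
proof -
  have "(\<Sum>k\<in>(UNIV :: ('d \<times> bool) set). f k) = (\<Sum>l\<in>UNIV. \<Sum>s\<in>UNIV. f (l, s))"
    by (simp add: sum.cartesian_product)
  then show ?thesis by (simp add: UNIV_bool add.commute)
qed

text \<open>
  The data of the scheme that its matrices depend on. The Hamiltonian enters only through its
  Lipschitz constants.
\<close>

locale grid_scheme =
  fixes \<Omega> :: "(real ^ 'd::finite) set" and dx lb Hu Hp :: real
    and J B :: "(int ^ 'd) set" and \<iota> :: "'v::finite \<Rightarrow> int ^ 'd" and \<nu> :: "'d \<Rightarrow> real"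
  assumes bounded_domain: "bounded \<Omega>"
    and grid: "uniform_grid \<Omega> dx J B \<iota>"
    and \<nu>_pos: "\<And>l. 0 < \<nu> l" and lb_pos: "0 < lb" and Hu_pos: "0 < Hu" and Hp_pos: "0 < Hp"
begin

definition R :: real where "R = sup_diameter \<Omega>"

definition interior_nodes :: "'v set" where "interior_nodes = {i. \<iota> i \<in> J}"

definition nb :: "'v \<Rightarrow> 'd \<times> bool \<Rightarrow> 'v" where "nb i k = inv \<iota> (\<iota> i + shift k)"

text \<open>
  The row of a linearized scheme at an interior node \<open>i\<close>: diffusion and transport contribute the weight
  \<open>\<nu> / dx\<^sup>2 + c / dx\<close> to each neighbour, and \<open>h\<close> is the slope of the Hamiltonian in \<open>u\<close>.
\<close>

definition stencil_row :: "'v \<Rightarrow> real \<Rightarrow> real ^ ('d \<times> bool) \<Rightarrow> real ^ 'v" where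
  "stencil_row i h c = h *\<^sub>R axis i 1 +
     (\<Sum>k\<in>UNIV. (\<nu> (fst k) / dx\<^sup>2 + c $ k / dx) *\<^sub>R (axis i 1 - axis (nb i k) 1))"

definition slopes :: "(real ^ ('d \<times> bool)) set" where
  "slopes = {c. (\<forall>k. 0 \<le> c $ k) \<and> (\<Sum>k\<in>UNIV. c $ k) \<le> Hp}"

definition rows :: "'v \<Rightarrow> (real ^ 'v) set" where
  "rows i = (if i \<in> interior_nodes
     then (\<lambda>(h, c). stencil_row i h c) ` ({0..Hu} \<times> slopes) else {lb *\<^sub>R axis i 1})"

lemma dx_pos: "0 < dx" and inj_\<iota>: "inj \<iota>"
  using grid by (auto simp: uniform_grid_def bij_betw_def)

lemma \<iota>_nb: "i \<in> interior_nodes \<Longrightarrow> \<iota> (nb i k) = \<iota> i + shift k"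
proof -
  assume "i \<in> interior_nodes"
  then have "\<iota> i + shift k \<in> range \<iota>"
    using grid unfolding uniform_grid_def bij_betw_def interior_nodes_def by blast
  then show ?thesis by (simp add: nb_def f_inv_into_f)
qed

lemma nb_inj_on: "inj_on (\<lambda>i. nb i k) interior_nodes"
proof (rule inj_onI)
  fix i j assume "i \<in> interior_nodes" "j \<in> interior_nodes" "nb i k = nb j k"
  then have "\<iota> i + shift k = \<iota> j + shift k" by (metis \<iota>_nb)
  then show "i = j" using inj_\<iota> by (simp add: inj_eq)
qed

lemma interior_coord_nb:
  "i \<in> interior_nodes \<Longrightarrow>
    \<iota> (nb i (l', s)) $ l = \<iota> i $ l + (if l' = l then if s then 1 else - 1 else 0)"
  by (auto simp: \<iota>_nb shift_def axis_def)

lemma interior_nodes_nonempty: "\<exists>i. i \<in> interior_nodes"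
  using grid unfolding uniform_grid_def bij_betw_def interior_nodes_def
  by (metis UnCI all_not_in_conv imageE mem_Collect_eq)

lemma coord_diff_le: "dx * real_of_int (\<iota> i $ l - \<iota> j $ l) \<le> R"
proof -
  have "node dx (\<iota> i) \<in> closure \<Omega>" for i
    using grid unfolding uniform_grid_def bij_betw_def by blast
  then have "infnorm (node dx (\<iota> i) - node dx (\<iota> j)) \<le> R"
    unfolding R_def by (intro infnorm_le_sup_diameter bounded_domain)
  moreover have "(node dx (\<iota> i) - node dx (\<iota> j)) $ l = dx * real_of_int (\<iota> i $ l - \<iota> j $ l)"
    by (simp add: node_def right_diff_distrib)
  ultimately show ?thesis
    using component_le_infnorm_cart[of "node dx (\<iota> i) - node dx (\<iota> j)" l] by simp
qed

lemma R_pos: "0 < R"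
proof -
  obtain i where i: "i \<in> interior_nodes" using interior_nodes_nonempty by blast
  have "dx \<le> R"
    using coord_diff_le[of "nb i (undefined, True)" undefined i] interior_coord_nb[OF i] by simp
  then show ?thesis using dx_pos by linarith
qed

definition lo :: "'d \<Rightarrow> int" where "lo l = Min (range (\<lambda>i. \<iota> i $ l))"
definition hi :: "'d \<Rightarrow> int" where "hi l = Max (range (\<lambda>i. \<iota> i $ l))"

lemma lo_le: "lo l \<le> \<iota> i $ l" and le_hi: "\<iota> i $ l \<le> hi l"
  by (auto simp: lo_def hi_def)

lemma width_le: "dx * real_of_int (hi l - lo l) \<le> R"
proof -
  have "hi l \<in> range (\<lambda>i. \<iota> i $ l)" "lo l \<in> range (\<lambda>i. \<iota> i $ l)"
    unfolding hi_def lo_def by (rule Max_in Min_in; auto)+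
  then show ?thesis using coord_diff_le by auto
qed

lemma interior_between:
  assumes i: "i \<in> interior_nodes"
  shows "lo l < \<iota> i $ l" "\<iota> i $ l < hi l"
  using lo_le[of l "nb i (l, False)"] le_hi[where i="nb i (l, True)" and l=l] interior_coord_nb[OF i, of l _ l] by auto

lemma stencil_row_inner:
  "stencil_row i h c \<bullet> x =
    h * x $ i + (\<Sum>k\<in>UNIV. (\<nu> (fst k) / dx\<^sup>2 + c $ k / dx) * (x $ i - x $ (nb i k)))"
  by (simp add: stencil_row_def inner_add_left inner_sum_left inner_diff_left inner_axis')

lemma stencil_row_nth:
  "stencil_row i h c $ j = (if i = j then h + (\<Sum>k\<in>UNIV. \<nu> (fst k) / dx\<^sup>2 + c $ k / dx) else 0)
    - (\<Sum>k\<in>UNIV. if nb i k = j then \<nu> (fst k) / dx\<^sup>2 + c $ k / dx else 0)"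
proof -
  have "stencil_row i h c $ j = stencil_row i h c \<bullet> axis j 1" by (simp add: inner_axis)
  also have "\<dots> = h * (if i = j then 1 else 0) + (\<Sum>k\<in>UNIV. (\<nu> (fst k) / dx\<^sup>2 + c $ k / dx) * (if i = j then 1 else 0)
      - (if nb i k = j then \<nu> (fst k) / dx\<^sup>2 + c $ k / dx else 0))"
    unfolding stencil_row_inner by (intro arg_cong2[where f="(+)"] sum.cong) (auto simp: axis_def)
  finally show ?thesis by (simp add: sum_subtractf)
qed

lemma slopes_nonneg: "c \<in> slopes \<Longrightarrow> 0 \<le> c $ k"
  and slopes_sum: "c \<in> slopes \<Longrightarrow> (\<Sum>k\<in>UNIV. c $ k) \<le> Hp"
  unfolding slopes_def by blast+

lemma slopes_le: "c \<in> slopes \<Longrightarrow> c $ k \<le> Hp"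
  using member_le_sum[of k UNIV "\<lambda>k. c $ k"] slopes_nonneg[of c] slopes_sum[of c] by fastforce

lemma weight_nonneg: "c \<in> slopes \<Longrightarrow> 0 \<le> \<nu> (fst k) / dx\<^sup>2 + c $ k / dx"
  using slopes_nonneg[of c k] \<nu>_pos[of "fst k"] dx_pos by (auto intro!: add_nonneg_nonneg divide_nonneg_nonneg)

lemma compact_convex_slopes: "compact slopes" "convex slopes"
proof -
  have "slopes = (\<Inter>k. {c. 0 \<le> c $ k}) \<inter> {c. (\<Sum>k\<in>UNIV. c $ k) \<le> Hp}"
    by (auto simp: slopes_def)
  moreover have "closed {c :: real ^ ('d \<times> bool). (0::real) \<le> c $ k}" for k
    by (intro closed_Collect_le continuous_intros)
  moreover have "closed {c :: real ^ ('d \<times> bool). (\<Sum>k\<in>UNIV. c $ k) \<le> Hp}"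
    by (intro closed_Collect_le continuous_intros)
  ultimately have "closed slopes" by (auto intro!: closed_Int closed_INT)
  moreover have "slopes \<subseteq> cbox 0 (\<chi> k. Hp)"
    by (auto simp: mem_box_cart slopes_nonneg slopes_le)
  then have "bounded slopes" using bounded_cbox bounded_subset by blast
  ultimately show "compact slopes" by (simp add: compact_eq_bounded_closed)
  show "convex slopes"
  proof (rule convexI)
    fix x y and a b :: real
    assume x: "x \<in> slopes" and y: "y \<in> slopes" and ab: "0 \<le> a" "0 \<le> b" "a + b = 1"
    have "(\<Sum>k\<in>UNIV. (a *\<^sub>R x + b *\<^sub>R y) $ k) = a * (\<Sum>k\<in>UNIV. x $ k) + b * (\<Sum>k\<in>UNIV. y $ k)"
      by (simp add: sum.distrib sum_distrib_left)
    also have "\<dots> \<le> a * Hp + b * Hp"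
      using ab slopes_sum x y by (intro add_mono mult_left_mono) auto
    also have "\<dots> = Hp" using ab by (simp flip: distrib_right)
    finally show "a *\<^sub>R x + b *\<^sub>R y \<in> slopes"
      using ab slopes_nonneg[OF x] slopes_nonneg[OF y] by (auto simp: slopes_def)
  qed
qed

lemma compact_rows: "compact (rows i)"
proof -
  have "continuous_on UNIV (\<lambda>p. stencil_row i (fst p) (snd p))"
    unfolding stencil_row_def using dx_pos by (intro continuous_intros) auto
  then have "compact ((\<lambda>(h, c). stencil_row i h c) ` ({0..Hu} \<times> slopes))"
    unfolding case_prod_unfold
    by (intro compact_continuous_image compact_Times compact_convex_slopes)
       (auto intro: continuous_on_subset)
  then show ?thesis by (simp add: rows_def)
qed

lemma convex_rows: "convex (rows i)"
proof (cases "i \<in> interior_nodes")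
  case True
  have "convex ((\<lambda>(h, c). stencil_row i h c) ` ({0..Hu} \<times> slopes))"
  proof (rule convexI)
    fix x y and a b :: real
    assume x: "x \<in> (\<lambda>(h, c). stencil_row i h c) ` ({0..Hu} \<times> slopes)"
      and y: "y \<in> (\<lambda>(h, c). stencil_row i h c) ` ({0..Hu} \<times> slopes)"
      and ab: "0 \<le> a" "0 \<le> b" "a + b = 1"
    from x obtain h c where hc: "(h, c) \<in> {0..Hu} \<times> slopes" "x = stencil_row i h c" by auto
    from y obtain h' c' where hc': "(h', c') \<in> {0..Hu} \<times> slopes" "y = stencil_row i h' c'" by auto
    have 1: "(\<nu> (fst k) / dx\<^sup>2 + (a * c $ k + b * c' $ k) / dx) =
        a * (\<nu> (fst k) / dx\<^sup>2 + c $ k / dx) + b * (\<nu> (fst k) / dx\<^sup>2 + c' $ k / dx)" for k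
    proof -
      have "a * (\<nu> (fst k) / dx\<^sup>2) + b * (\<nu> (fst k) / dx\<^sup>2) = \<nu> (fst k) / dx\<^sup>2"
        using ab(3) by (metis distrib_right mult_1)
      then show ?thesis by (simp add: distrib_left add_divide_distrib)
    qed
    have "stencil_row i (a * h + b * h') (a *\<^sub>R c + b *\<^sub>R c') = a *\<^sub>R x + b *\<^sub>R y"
      unfolding hc hc' stencil_row_def vector_add_component vector_scaleR_component real_scaleR_def 1
      by (simp only: scaleR_add_left[of "a * _" "b * _"] scaleR_add_right sum.distrib
          scaleR_sum_right scaleR_scaleR add_ac)
    moreover have "a *\<^sub>R (h, c) + b *\<^sub>R (h', c') \<in> {0..Hu} \<times> slopes"
      by (rule convexD[OF convex_Times[OF convex_real_interval(5) compact_convex_slopes(2)] hc(1) hc'(1) ab])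
    ultimately show "a *\<^sub>R x + b *\<^sub>R y \<in> (\<lambda>(h, c). stencil_row i h c) ` ({0..Hu} \<times> slopes)"
      by force
  qed
  then show ?thesis using True by (simp add: rows_def)
qed (simp add: rows_def)

lemma interior_rowE:
  assumes "A \<in> row_family rows" "i \<in> interior_nodes"
  obtains h c where "0 \<le> h" "h \<le> Hu" "c \<in> slopes" "A $ i = stencil_row i h c"
proof -
  have "A $ i \<in> rows i" using assms(1) by (simp add: row_family_def)
  then show thesis using assms(2) that by (auto simp: rows_def)
qed

lemma boundary_row:
  assumes "A \<in> row_family rows" "i \<notin> interior_nodes"
  shows "A $ i = lb *\<^sub>R axis i 1"
proof -
  have "A $ i \<in> rows i" using assms(1) by (simp add: row_family_def)
  then show ?thesis using assms(2) by (simp add: rows_def)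
qed

lemma residual_interior:
  assumes i: "i \<in> interior_nodes"
  shows "residual \<iota> J dx \<nu> lb H g u $ i =
    (\<Sum>k\<in>UNIV. \<nu> (fst k) / dx\<^sup>2 * (u $ i - u $ (nb i k)))
      + H (node dx (\<iota> i)) (u $ i) (\<chi> k. (u $ i - u $ (nb i k)) / dx)"
proof -
  have neg: "\<iota> i + axis l (- 1) = \<iota> i - axis l 1" for l
    by (simp add: vec_eq_iff axis_def)
  have "(\<Sum>l\<in>UNIV. \<nu> l * ((2 * u $ i - u $ inv \<iota> (\<iota> i - axis l 1) - u $ inv \<iota> (\<iota> i + axis l 1)) / dx\<^sup>2))
    = (\<Sum>k\<in>UNIV. \<nu> (fst k) / dx\<^sup>2 * (u $ i - u $ (nb i k)))"
    unfolding sum_directions by (intro sum.cong) (auto simp: nb_def shift_def neg algebra_simps simp flip: add_divide_distrib diff_divide_distrib)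
  then show ?thesis
    using i inj_\<iota> by (simp add: residual_def Let_def grid_val_def num_gradient_def interior_nodes_def nb_def)
qed

lemma residual_boundary:
  "i \<notin> interior_nodes \<Longrightarrow> residual \<iota> J dx \<nu> lb H g u $ i = lb * (u $ i - g (\<iota> i))"
  using inj_\<iota> by (simp add: residual_def Let_def grid_val_def interior_nodes_def)

text \<open>
  The increment of the Hamiltonian is split into a change of the gradient at fixed \<open>u\<close>, whose
  secant is an admissible slope vector, and a change of \<open>u\<close>, whose difference quotient \<open>h\<close> lies between \<open>0\<close> and
  \<open>Hu\<close>.
\<close>

lemma residual_secant_family:
  assumes H1_u: "\<And>j u v p. j \<in> J \<Longrightarrow>
          \<bar>H (node dx j) u p - H (node dx j) v p\<bar> \<le> Hu * \<bar>u - v\<bar>"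
    and H1_p: "\<And>j u p q. j \<in> J \<Longrightarrow>
          \<bar>H (node dx j) u p - H (node dx j) u q\<bar> \<le> Hp * infnorm (p - q)"
    and H2_p: "\<And>j u p q. j \<in> J \<Longrightarrow> p \<le> q \<Longrightarrow> H (node dx j) u p \<le> H (node dx j) u q"
    and H2_u: "\<And>j u v p. j \<in> J \<Longrightarrow> u \<le> v \<Longrightarrow> H (node dx j) u p \<le> H (node dx j) v p"
  shows "secant_family (residual \<iota> J dx \<nu> lb H g) rows"
proof -
  let ?F = "residual \<iota> J dx \<nu> lb H g"
  have row: "\<exists>a\<in>rows i. (?F u - ?F v) $ i = a \<bullet> (u - v)" for u v i
  proof (cases "i \<in> interior_nodes")
    case True
    then have j: "\<iota> i \<in> J" by (simp add: interior_nodes_def)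
    define p where "p = (\<chi> k. (u $ i - u $ (nb i k)) / dx)"
    define q where "q = (\<chi> k. (v $ i - v $ (nb i k)) / dx)"
    let ?H = "H (node dx (\<iota> i))"
    obtain c where c: "c \<in> slopes" "?H (u $ i) p - ?H (u $ i) q = c \<bullet> (p - q)"
    proof -
      from monotone_lipschitz_secant[of "?H (u $ i)" Hp p q,
          OF H1_p[OF j] less_imp_le[OF Hp_pos] H2_p[OF j]]
      obtain c where "\<forall>k. 0 \<le> c $ k" "(\<Sum>k\<in>UNIV. c $ k) \<le> Hp"
        "?H (u $ i) p - ?H (u $ i) q = c \<bullet> (p - q)" by metis
      then show thesis by (intro that[of c]) (simp_all only: slopes_def mem_Collect_eq simp_thms)
    qed
    define h where "h = (?H (u $ i) q - ?H (v $ i) q) / (u $ i - v $ i)"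
    have h: "0 \<le> h" "h \<le> Hu" "?H (u $ i) q - ?H (v $ i) q = h * (u $ i - v $ i)"
    proof -
      have "0 \<le> h \<and> h \<le> Hu" unfolding h_def
      proof (cases "u $ i" "v $ i" rule: linorder_cases)
        case less
        then show "0 \<le> (?H (u $ i) q - ?H (v $ i) q) / (u $ i - v $ i) \<and> (?H (u $ i) q - ?H (v $ i) q) / (u $ i - v $ i) \<le> Hu"
          using H1_u[OF j, of "u $ i" q "v $ i"] H2_u[OF j, of "u $ i" "v $ i" q]
          by (auto simp: divide_nonpos_neg neg_divide_le_eq algebra_simps)
      next
        case greater
        then show "0 \<le> (?H (u $ i) q - ?H (v $ i) q) / (u $ i - v $ i) \<and> (?H (u $ i) q - ?H (v $ i) q) / (u $ i - v $ i) \<le> Hu"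
          using H1_u[OF j, of "u $ i" q "v $ i"] H2_u[OF j, of "v $ i" "u $ i" q]
          by (auto simp: pos_divide_le_eq)
      qed (use Hu_pos in auto)
      then show "0 \<le> h" "h \<le> Hu" by auto
      show "?H (u $ i) q - ?H (v $ i) q = h * (u $ i - v $ i)" by (simp add: h_def)
    qed
    have pq: "c \<bullet> (p - q) = (\<Sum>k\<in>UNIV. c $ k / dx * ((u - v) $ i - (u - v) $ nb i k))"
      unfolding inner_vec_def p_def q_def
      by (simp add: algebra_simps flip: add_divide_distrib diff_divide_distrib)
    have "(?F u - ?F v) $ i = (\<Sum>k\<in>UNIV. \<nu> (fst k) / dx\<^sup>2 * (u $ i - u $ (nb i k)))
        - (\<Sum>k\<in>UNIV. \<nu> (fst k) / dx\<^sup>2 * (v $ i - v $ (nb i k)))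
        + (?H (u $ i) p - ?H (u $ i) q) + (?H (u $ i) q - ?H (v $ i) q)"
      by (simp add: residual_interior[OF True] p_def q_def)
    also have "\<dots> = stencil_row i h c \<bullet> (u - v)"
      unfolding c(2) pq h(3) stencil_row_inner sum_subtractf[symmetric]
      by (simp add: sum.distrib[symmetric] algebra_simps)
    finally show ?thesis
      using True h c by (intro bexI[of _ "stencil_row i h c"]) (auto simp: rows_def intro!: image_eqI[of _ _ "(h, c)"])
  qed (simp add: rows_def residual_boundary inner_axis' right_diff_distrib)
  have "\<exists>A\<in>row_family rows. ?F u - ?F v = A *v (u - v)" for u v
  proof -
    have "\<forall>i. \<exists>a. a \<in> rows i \<and> (?F u - ?F v) $ i = a \<bullet> (u - v)"
      using row by blast
    from choice[OF this] obtain a where a: "\<And>i. a i \<in> rows i"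
      "\<And>i. (?F u - ?F v) $ i = a i \<bullet> (u - v)" by blast
    have "(\<chi> i. a i) \<in> row_family rows" by (simp add: row_family_def a)
    moreover have "?F u - ?F v = (\<chi> i. a i) *v (u - v)"
      by (simp add: vec_eq_iff matrix_vector_mult_row a(2)[symmetric] del: vector_minus_component)
    ultimately show ?thesis by blast
  qed
  then show ?thesis by (simp add: secant_family_def compact_rows convex_rows)
qed

section \<open>Stability in the maximum norm\<close>

text \<open>
  The barrier decreases geometrically in the direction \<open>l\<close>, with ratio \<open>\<kappa> = 1 + 2 Hp dx / \<nu>\<close>. A slope of at most
  \<open>Hp\<close> towards the lower neighbour then consumes half of the diffusion:
  \<open>(\<nu> / dx\<^sup>2) (\<kappa> - 1) - Hp / dx = Hp / dx\<close>. There are at most \<open>R / dx\<close> steps, and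
  \<open>\<kappa> ^ (R / dx) \<le> exp (2 Hp R / \<nu>)\<close> bounds the height. The constant \<open>1 / lb\<close> takes care of the boundary rows.
\<close>

lemma barrier:
  obtains w :: "real ^ 'v" where "\<And>i. 0 < w $ i"
    "\<And>i. w $ i \<le> \<nu> l / (2 * Hp\<^sup>2) * exp (2 * Hp / \<nu> l * R) + 1 / lb"
    "\<And>A i. A \<in> row_family rows \<Longrightarrow> 1 \<le> (A *v w) $ i"
proof -
  define \<kappa> where "\<kappa> = 1 + 2 * Hp * dx / \<nu> l"
  define \<beta> where "\<beta> = \<nu> l / (2 * Hp\<^sup>2)"
  define n where "n i = nat (\<iota> i $ l - lo l)" for i
  define N where "N = nat (hi l - lo l)"
  define w :: "real ^ 'v" where "w = (\<chi> i. \<beta> * (\<kappa> ^ N - \<kappa> ^ n i) + 1 / lb)"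
  have \<kappa>: "1 < \<kappa>" using Hp_pos dx_pos \<nu>_pos[of l] by (simp add: \<kappa>_def)
  have \<beta>: "0 < \<beta>" using Hp_pos \<nu>_pos[of l] by (simp add: \<beta>_def)
  have nN: "n i \<le> N" for i using lo_le[of l i] le_hi[of i l] by (simp add: n_def N_def)
  have w_ge: "1 / lb \<le> w $ i" for i
    using \<kappa> \<beta> power_increasing[OF nN, of \<kappa> i] by (simp add: w_def)
  have w_pos: "0 < w $ i" for i
    using w_ge[of i] lb_pos by (smt (verit) divide_pos_pos)
  show thesis
  proof (rule that[of w])
    show "0 < w $ i" for i by (rule w_pos)
    have "\<kappa> ^ N \<le> exp (2 * Hp / \<nu> l * R)"
    proof -
      have "\<kappa> ^ N \<le> exp (2 * Hp * dx / \<nu> l) ^ N"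
        using \<kappa> exp_ge_add_one_self[of "2 * Hp * dx / \<nu> l"] by (intro power_mono) (auto simp: \<kappa>_def)
      also have "\<dots> = exp (2 * Hp / \<nu> l * (dx * real N))"
        by (simp add: exp_of_nat_mult[symmetric] mult_ac)
      also have "\<dots> \<le> exp (2 * Hp / \<nu> l * R)"
      proof -
        have "real N = real_of_int (hi l - lo l)"
          using lo_le[of l undefined] le_hi[of undefined l] by (simp add: N_def)
        then have "dx * real N \<le> R" using width_le[of l] by simp
        then show ?thesis using Hp_pos \<nu>_pos[of l] by (simp add: mult_left_mono divide_right_mono)
      qed
      finally show ?thesis .
    qed
    then have "\<beta> * (\<kappa> ^ N - \<kappa> ^ n i) \<le> \<beta> * exp (2 * Hp / \<nu> l * R)" for i
      using \<kappa> \<beta> by (intro mult_left_mono) (auto intro: order_trans[of _ "\<kappa> ^ N"])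
    then show "w $ i \<le> \<nu> l / (2 * Hp\<^sup>2) * exp (2 * Hp / \<nu> l * R) + 1 / lb" for i
      by (simp add: w_def \<beta>_def)
    show "1 \<le> (A *v w) $ i" if A: "A \<in> row_family rows" for A i
    proof (cases "i \<in> interior_nodes")
      case True
      obtain h c where hc: "0 \<le> h" "c \<in> slopes" "A $ i = stencil_row i h c"
        using interior_rowE[OF A True] by metis
      define a where "a k = \<nu> (fst k) / dx\<^sup>2 + c $ k / dx" for k
      obtain q where q: "n i = Suc q"
        using interior_between[OF True, of l] by (cases "n i") (auto simp: n_def)
      have nb_l: "n (nb i (l, True)) = Suc (Suc q)" "n (nb i (l, False)) = q"
        using q by (auto simp: n_def interior_coord_nb[OF True])
      have nb_other: "n (nb i (l', s)) = n i" if "l' \<noteq> l" for l' s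
        using that by (simp add: n_def interior_coord_nb[OF True])
      have "(\<Sum>k\<in>UNIV. a k * (w $ i - w $ nb i k)) =
          a (l, True) * (w $ i - w $ nb i (l, True)) + a (l, False) * (w $ i - w $ nb i (l, False))"
        unfolding sum_directions
        by (subst sum.remove[of _ l]) (auto simp: w_def nb_other intro!: sum.neutral)
      \<comment> \<open>With \<open>n i = q + 1\<close>, both differences of powers contain the factor \<open>\<kappa> ^ q (\<kappa> - 1)\<close>.\<close>
      also have "\<dots> = \<beta> * \<kappa> ^ q * (\<kappa> - 1) * (a (l, True) * \<kappa> - a (l, False))"
        by (simp add: w_def q nb_l) algebra
      also have "\<dots> \<ge> \<beta> * \<kappa> ^ q * (\<kappa> - 1) * (\<nu> l / dx\<^sup>2 * \<kappa> - (\<nu> l / dx\<^sup>2 + Hp / dx))"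
      proof (intro mult_left_mono diff_mono mult_right_mono)
        show "\<nu> l / dx\<^sup>2 \<le> a (l, True)" "a (l, False) \<le> \<nu> l / dx\<^sup>2 + Hp / dx"
          using slopes_nonneg[OF hc(2)] slopes_le[OF hc(2)] dx_pos
          by (auto simp: a_def divide_right_mono)
      qed (use \<kappa> \<beta> in auto)
      also have "\<beta> * \<kappa> ^ q * (\<kappa> - 1) * (\<nu> l / dx\<^sup>2 * \<kappa> - (\<nu> l / dx\<^sup>2 + Hp / dx)) = \<kappa> ^ q"
        using \<nu>_pos[of l] Hp_pos dx_pos
        by (simp add: \<beta>_def \<kappa>_def field_simps power2_eq_square)
      also have "1 \<le> \<kappa> ^ q" using \<kappa> by simp
      finally have "1 \<le> (\<Sum>k\<in>UNIV. a k * (w $ i - w $ nb i k))" .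
      moreover have "0 \<le> h * w $ i" using hc(1) w_pos[of i] by simp
      ultimately show ?thesis
        by (simp add: matrix_vector_mult_row hc(3) stencil_row_inner a_def)
    next
      case False
      have "1 = lb * (1 / lb)" using lb_pos by simp
      also have "\<dots> \<le> lb * w $ i" using lb_pos by (intro mult_left_mono w_ge) simp
      finally show ?thesis
        by (simp add: matrix_vector_mult_row boundary_row[OF A False] inner_axis')
    qed
  qed
qed

lemma off_diagonal_nonpos:
  assumes A: "A \<in> row_family rows" and "i \<noteq> j"
  shows "A $ i $ j \<le> 0"
proof (cases "i \<in> interior_nodes")
  case True
  obtain h c where hc: "c \<in> slopes" "A $ i = stencil_row i h c"
    using interior_rowE[OF A True] by metis
  then show ?thesis
    using assms(2) weight_nonneg[OF hc(1)] by (auto simp: stencil_row_nth intro!: sum_nonneg)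
qed (use assms in \<open>simp add: boundary_row axis_def\<close>)

lemma infnorm_stability:
  assumes A: "A \<in> row_family rows"
  shows "infnorm x \<le> (\<nu> l / (2 * Hp\<^sup>2) * exp (2 * Hp / \<nu> l * R) + 1 / lb) * infnorm (A *v x)"
proof -
  obtain w :: "real ^ 'v" where w: "\<And>i. 0 < w $ i"
    "\<And>i. w $ i \<le> \<nu> l / (2 * Hp\<^sup>2) * exp (2 * Hp / \<nu> l * R) + 1 / lb"
    "\<And>i. 1 \<le> (A *v w) $ i"
    using barrier[of l] A by metis
  show ?thesis by (rule barrier_estimate[OF off_diagonal_nonpos[OF A] w(1,2,3)])
qed

lemma norm_stability:
  "\<exists>c\<ge>0. \<forall>A\<in>row_family rows. \<forall>x. norm x \<le> c * norm (A *v x)"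
proof -
  fix l :: 'd
  let ?C = "\<nu> l / (2 * Hp\<^sup>2) * exp (2 * Hp / \<nu> l * R) + 1 / lb"
  let ?d = "sqrt (real (DIM(real ^ 'v)))"
  have C: "0 \<le> ?C" using \<nu>_pos[of l] lb_pos by simp
  have "norm x \<le> ?d * ?C * norm (A *v x)" if A: "A \<in> row_family rows" for A x
  proof -
    have "norm x \<le> ?d * infnorm x" by (rule norm_le_infnorm)
    also have "\<dots> \<le> ?d * (?C * infnorm (A *v x))"
      by (intro mult_left_mono infnorm_stability A) simp
    also have "\<dots> \<le> ?d * (?C * norm (A *v x))"
      using C by (intro mult_left_mono infnorm_le_norm) auto
    finally show ?thesis by (simp add: mult.assoc)
  qed
  moreover have "0 \<le> ?d * ?C" using C by simp
  ultimately show ?thesis by blast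
qed

section \<open>Discrete Poincare inequality and coercivity\<close>

text \<open>
  Translation by \<open>k\<close> is injective, so it visits each interior node at most once.
\<close>

lemma sum_nb_le:
  assumes nonneg: "\<And>j. 0 \<le> (f j :: real)" and zero: "\<And>j. j \<notin> interior_nodes \<Longrightarrow> f j = 0"
  shows "(\<Sum>i\<in>interior_nodes. f (nb i k)) \<le> (\<Sum>j\<in>interior_nodes. f j)"
proof -
  have "(\<Sum>i\<in>interior_nodes. f (nb i k)) = sum f ((\<lambda>i. nb i k) ` interior_nodes)"
    by (simp add: sum.reindex nb_inj_on)
  also have "\<dots> \<le> sum f UNIV" by (rule sum_mono2) (auto simp: nonneg)
  also have "\<dots> = sum f interior_nodes"
    by (rule sum.mono_neutral_right) (auto simp: zero)
  finally show ?thesis .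
qed

text \<open>
  The parabola \<open>\<phi>(t) = (t - lo) (hi - t)\<close> is positive inside and non-negative on the grid, and its
  second difference is \<open>- 2\<close>. Young's inequality with weights
  \<open>\<phi>(t \<plusminus> 1) / \<phi>(t)\<close> on the products of neighbours (a discrete Picone identity) leaves the local lower bound
  \<open>2 (z $ i)\<^sup>2 / \<phi>\<close>, and \<open>\<phi> \<le> (R / dx)\<^sup>2 / 4\<close>. The argument is local, hence indifferent to the shape of the grid and
  to how often a line meets its boundary.
\<close>

lemma discrete_poincare:
  fixes z :: "real ^ 'v"
  assumes z: "\<And>i. i \<notin> interior_nodes \<Longrightarrow> z $ i = 0"
  shows "8 * dx\<^sup>2 / R\<^sup>2 * (\<Sum>i\<in>interior_nodes. (z $ i)\<^sup>2) \<le>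
    (\<Sum>i\<in>interior_nodes. z $ i * (2 * z $ i - z $ nb i (l, True) - z $ nb i (l, False)))"
proof -
  define \<phi> :: "int \<Rightarrow> real" where "\<phi> t = real_of_int ((t - lo l) * (hi l - t))" for t
  let ?t = "\<lambda>i. \<iota> i $ l"
  have \<phi>_pos: "0 < \<phi> (?t i)" if "i \<in> interior_nodes" for i
    using interior_between[OF that, of l] by (simp add: \<phi>_def)
  have \<phi>_nonneg: "0 \<le> \<phi> (?t i)" for i
    using lo_le[of l i] le_hi[of i l] by (simp add: \<phi>_def)
  have \<phi>_le: "\<phi> (?t i) \<le> R\<^sup>2 / (4 * dx\<^sup>2)" for i
  proof -
    let ?a = "real_of_int (?t i - lo l)" and ?b = "real_of_int (hi l - ?t i)"
    have "4 * (?a * ?b) = (?a + ?b)\<^sup>2 - (?a - ?b)\<^sup>2" by algebra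
    also have "\<dots> \<le> (?a + ?b)\<^sup>2" by simp
    finally have "dx\<^sup>2 * (4 * (?a * ?b)) \<le> (dx * (?a + ?b))\<^sup>2"
      by (simp add: power_mult_distrib mult_left_mono)
    also have "\<dots> \<le> R\<^sup>2"
      using width_le[of l] dx_pos lo_le[of l i] le_hi[of i l] by (intro power_mono) auto
    finally show ?thesis using dx_pos by (simp add: \<phi>_def pos_le_divide_eq mult_ac)
  qed
  have young: "x * y \<le> (x\<^sup>2 * q / p + y\<^sup>2 * p / q) / 2"
    if "0 < p" "0 \<le> q" "q = 0 \<Longrightarrow> y = 0" for x y p q :: real
  proof (cases "q = 0")
    case False
    then have q: "0 < q" using that by simp
    have "0 \<le> (x * q - y * p)\<^sup>2 / (p * q)" using that q by simp
    also have "\<dots> = x\<^sup>2 * q / p + y\<^sup>2 * p / q - 2 * (x * y)"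
      using that(1) q by (simp add: field_simps power2_eq_square)
    finally show ?thesis by simp
  qed (use that in simp)
  have cross: "(\<Sum>i\<in>interior_nodes. z $ i * z $ nb i (l, s)) \<le>
      (\<Sum>i\<in>interior_nodes. (z $ i)\<^sup>2 * (\<phi> (?t i + (if s then 1 else - 1)) / \<phi> (?t i))
        + (z $ i)\<^sup>2 * (\<phi> (?t i - (if s then 1 else - 1)) / \<phi> (?t i))) / 2" for s
  proof -
    let ?\<sigma> = "if s then 1 else - 1 :: int"
    have t_nb: "?t (nb i (l, s)) = ?t i + ?\<sigma>" if "i \<in> interior_nodes" for i
      using interior_coord_nb[OF that, of l s l] by simp
    \<comment> \<open>The half of the Young bound that belongs to the neighbour, as a function of the neighbour alone.
      Division by zero is harmless: \<open>f\<close> vanishes at boundary nodes because \<open>z\<close> does.\<close>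
    define f where "f j = (z $ j)\<^sup>2 * \<phi> (?t j - ?\<sigma>) / \<phi> (?t j)" for j
    have f_nonneg: "0 \<le> f j" for j
    proof (cases "j \<in> interior_nodes")
      case True
      have "\<phi> (?t j - ?\<sigma>) = \<phi> (?t (nb j (l, \<not> s)))"
        using interior_coord_nb[OF True, of l "\<not> s" l] by simp
      then show ?thesis by (simp add: f_def \<phi>_nonneg)
    qed (simp add: f_def z)
    have "z $ i * z $ nb i (l, s) \<le> ((z $ i)\<^sup>2 * \<phi> (?t i + ?\<sigma>) / \<phi> (?t i) + f (nb i (l, s))) / 2"
      if i: "i \<in> interior_nodes" for i
    proof -
      have "z $ i * z $ nb i (l, s) \<le> ((z $ i)\<^sup>2 * \<phi> (?t (nb i (l, s))) / \<phi> (?t i)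
          + (z $ nb i (l, s))\<^sup>2 * \<phi> (?t i) / \<phi> (?t (nb i (l, s)))) / 2"
        using \<phi>_pos z by (intro young \<phi>_pos[OF i] \<phi>_nonneg) (metis less_irrefl)
      then show ?thesis by (simp add: f_def t_nb[OF i])
    qed
    then have "(\<Sum>i\<in>interior_nodes. z $ i * z $ nb i (l, s)) \<le>
        (\<Sum>i\<in>interior_nodes. ((z $ i)\<^sup>2 * \<phi> (?t i + ?\<sigma>) / \<phi> (?t i) + f (nb i (l, s))) / 2)"
      by (rule sum_mono)
    also have "\<dots> = ((\<Sum>i\<in>interior_nodes. (z $ i)\<^sup>2 * \<phi> (?t i + ?\<sigma>) / \<phi> (?t i))
        + (\<Sum>i\<in>interior_nodes. f (nb i (l, s)))) / 2"
      by (simp add: sum_divide_distrib[symmetric] sum.distrib)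
    also have "\<dots> \<le> ((\<Sum>i\<in>interior_nodes. (z $ i)\<^sup>2 * \<phi> (?t i + ?\<sigma>) / \<phi> (?t i))
        + (\<Sum>i\<in>interior_nodes. f i)) / 2"
      by (intro divide_right_mono add_left_mono sum_nb_le f_nonneg) (simp_all add: f_def z)
    finally show ?thesis by (simp add: f_def sum.distrib)
  qed
  have "(\<Sum>i\<in>interior_nodes. z $ i * z $ nb i (l, True)) + (\<Sum>i\<in>interior_nodes. z $ i * z $ nb i (l, False))
      \<le> (\<Sum>i\<in>interior_nodes. (z $ i)\<^sup>2 * ((\<phi> (?t i + 1) + \<phi> (?t i - 1)) / \<phi> (?t i)))"
    using cross[of True] cross[of False]
    by (simp add: sum.distrib add_divide_distrib distrib_left)
  also have "\<dots> = (\<Sum>i\<in>interior_nodes. (z $ i)\<^sup>2 * (2 - 2 / \<phi> (?t i)))"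
  proof (intro sum.cong refl arg_cong2[where f="(*)"])
    fix i assume i: "i \<in> interior_nodes"
    have "\<phi> (?t i + 1) + \<phi> (?t i - 1) = 2 * \<phi> (?t i) - 2"
      unfolding \<phi>_def of_int_add[symmetric] by (simp add: algebra_simps)
    then show "(\<phi> (?t i + 1) + \<phi> (?t i - 1)) / \<phi> (?t i) = 2 - 2 / \<phi> (?t i)"
      using \<phi>_pos[OF i] by (simp add: field_simps)
  qed
  finally have "(\<Sum>i\<in>interior_nodes. (z $ i)\<^sup>2 * (2 / \<phi> (?t i))) \<le>
      (\<Sum>i\<in>interior_nodes. z $ i * (2 * z $ i - z $ nb i (l, True) - z $ nb i (l, False)))"
    by (simp add: right_diff_distrib sum_subtractf sum.distrib power2_eq_square algebra_simps)
  moreover have "8 * dx\<^sup>2 / R\<^sup>2 * (\<Sum>i\<in>interior_nodes. (z $ i)\<^sup>2) \<le>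
      (\<Sum>i\<in>interior_nodes. (z $ i)\<^sup>2 * (2 / \<phi> (?t i)))"
    unfolding sum_distrib_left
  proof (rule sum_mono)
    fix i assume i: "i \<in> interior_nodes"
    have "8 * dx\<^sup>2 / R\<^sup>2 = 2 / (R\<^sup>2 / (4 * dx\<^sup>2))" by simp
    also have "\<dots> \<le> 2 / \<phi> (?t i)"
      using \<phi>_le[of i] \<phi>_pos[OF i] R_pos dx_pos
      by (intro divide_left_mono) (auto intro!: divide_pos_pos mult_pos_pos)
    finally have "8 * dx\<^sup>2 / R\<^sup>2 * (z $ i)\<^sup>2 \<le> 2 / \<phi> (?t i) * (z $ i)\<^sup>2"
      by (rule mult_right_mono) simp
    then show "8 * dx\<^sup>2 / R\<^sup>2 * (z $ i)\<^sup>2 \<le> (z $ i)\<^sup>2 * (2 / \<phi> (?t i))"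
      by (simp only: mult.commute)
  qed
  ultimately show ?thesis by linarith
qed

definition m :: real where "m = 4 / R\<^sup>2 * (\<Sum>l\<in>UNIV. \<nu> l) - 4 * Hp * real CARD('d) / dx"

text \<open>
  Diffusion provides \<open>8 / R\<^sup>2\<close> times the sum of the \<open>\<nu> l\<close> by the Poincare inequality, twice the amount in \<open>m\<close>. Each
  transport term \<open>c z $ i (z $ i - z $ j)\<close> costs at most \<open>c (z $ j)\<^sup>2 / 4\<close>, and each node is the neighbour in a given
  direction of at most one other, so the total cost
  \<open>Hp d / (2 dx)\<close> is below the \<open>4 Hp d / dx\<close> subtracted in \<open>m\<close>.
\<close>

lemma interior_coercive:
  fixes z :: "real ^ 'v"
  assumes A: "A \<in> row_family rows" and z: "\<And>i. i \<notin> interior_nodes \<Longrightarrow> z $ i = 0"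
  shows "m * (\<Sum>i\<in>interior_nodes. (z $ i)\<^sup>2) \<le> (\<Sum>i\<in>interior_nodes. z $ i * (A *v z) $ i)"
proof -
  define Z where "Z = (\<Sum>i\<in>interior_nodes. (z $ i)\<^sup>2)"
  have Z: "0 \<le> Z" by (simp add: Z_def sum_nonneg)
  have local_bound: "(\<Sum>k\<in>UNIV. \<nu> (fst k) / dx\<^sup>2 * (z $ i * (z $ i - z $ nb i k)))
      - (\<Sum>k\<in>UNIV. Hp / (4 * dx) * (z $ nb i k)\<^sup>2) \<le> z $ i * (A *v z) $ i"
    if i: "i \<in> interior_nodes" for i
  proof -
    obtain h c where hc: "0 \<le> h" "c \<in> slopes" "A $ i = stencil_row i h c"
      using interior_rowE[OF A i] by metis
    have low: "- (Hp / (4 * dx) * (z $ nb i k)\<^sup>2) \<le> c $ k / dx * (z $ i * (z $ i - z $ nb i k))" for k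
    proof -
      have "0 \<le> (z $ i - z $ nb i k / 2)\<^sup>2" by simp
      then have "- ((z $ nb i k)\<^sup>2 / 4) \<le> z $ i * (z $ i - z $ nb i k)"
        by (simp add: power2_eq_square algebra_simps)
      then have "c $ k / dx * (- ((z $ nb i k)\<^sup>2 / 4)) \<le> c $ k / dx * (z $ i * (z $ i - z $ nb i k))"
        using slopes_nonneg[OF hc(2)] dx_pos by (intro mult_left_mono) auto
      moreover have "c $ k / dx * ((z $ nb i k)\<^sup>2 / 4) \<le> Hp / dx * ((z $ nb i k)\<^sup>2 / 4)"
        using slopes_le[OF hc(2)] dx_pos by (intro mult_right_mono divide_right_mono) auto
      ultimately show ?thesis by simp
    qed
    have "z $ i * (A *v z) $ i = h * (z $ i)\<^sup>2
        + (\<Sum>k\<in>UNIV. \<nu> (fst k) / dx\<^sup>2 * (z $ i * (z $ i - z $ nb i k))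
           + c $ k / dx * (z $ i * (z $ i - z $ nb i k)))"
      unfolding matrix_vector_mult_row hc(3) stencil_row_inner
      by (simp add: distrib_left sum_distrib_left power2_eq_square distrib_right mult_ac)
    moreover have "0 \<le> h * (z $ i)\<^sup>2" using hc(1) by simp
    moreover have "(\<Sum>k\<in>UNIV. \<nu> (fst k) / dx\<^sup>2 * (z $ i * (z $ i - z $ nb i k)))
        - (\<Sum>k\<in>UNIV. Hp / (4 * dx) * (z $ nb i k)\<^sup>2)
        \<le> (\<Sum>k\<in>UNIV. \<nu> (fst k) / dx\<^sup>2 * (z $ i * (z $ i - z $ nb i k))
           + c $ k / dx * (z $ i * (z $ i - z $ nb i k)))"
      unfolding sum_subtractf[symmetric] using low by (intro sum_mono) (simp add: add_left_mono)
    ultimately show ?thesis by linarith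
  qed
  have diffusion: "8 / R\<^sup>2 * (\<Sum>l\<in>UNIV. \<nu> l) * Z \<le>
      (\<Sum>i\<in>interior_nodes. \<Sum>k\<in>UNIV. \<nu> (fst k) / dx\<^sup>2 * (z $ i * (z $ i - z $ nb i k)))"
  proof -
    have "8 / R\<^sup>2 * (\<Sum>l\<in>UNIV. \<nu> l) * Z = (\<Sum>l\<in>UNIV. \<nu> l / dx\<^sup>2 * (8 * dx\<^sup>2 / R\<^sup>2 * Z))"
      using dx_pos by (simp add: sum_distrib_left sum_distrib_right sum_divide_distrib mult_ac)
    also have "\<dots> \<le> (\<Sum>l\<in>UNIV. \<nu> l / dx\<^sup>2 *
        (\<Sum>i\<in>interior_nodes. z $ i * (2 * z $ i - z $ nb i (l, True) - z $ nb i (l, False))))"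
      unfolding Z_def using \<nu>_pos
      by (intro sum_mono mult_left_mono discrete_poincare z) (auto simp: less_imp_le)
    also have "\<dots> = (\<Sum>i\<in>interior_nodes. \<Sum>l\<in>UNIV. \<nu> l / dx\<^sup>2 *
        (z $ i * (2 * z $ i - z $ nb i (l, True) - z $ nb i (l, False))))"
      unfolding sum_distrib_left by (rule sum.swap)
    also have "\<dots> = (\<Sum>i\<in>interior_nodes. \<Sum>k\<in>UNIV. \<nu> (fst k) / dx\<^sup>2 * (z $ i * (z $ i - z $ nb i k)))"
      unfolding sum_directions fst_conv distrib_left[symmetric]
      by (intro sum.cong refl arg_cong2[where f="(*)"]) (simp add: algebra_simps)
    finally show ?thesis .
  qed
  have transport: "(\<Sum>i\<in>interior_nodes. \<Sum>k\<in>(UNIV :: ('d \<times> bool) set). Hp / (4 * dx) * (z $ nb i k)\<^sup>2)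
      \<le> 4 * Hp * real CARD('d) / dx * Z"
  proof -
    have "(\<Sum>i\<in>interior_nodes. \<Sum>k\<in>(UNIV :: ('d \<times> bool) set). Hp / (4 * dx) * (z $ nb i k)\<^sup>2)
        = Hp / (4 * dx) * (\<Sum>k\<in>(UNIV :: ('d \<times> bool) set). \<Sum>i\<in>interior_nodes. (z $ nb i k)\<^sup>2)"
      unfolding sum_distrib_left[symmetric] by (subst sum.swap) (rule refl)
    also have "\<dots> \<le> Hp / (4 * dx) * (\<Sum>k\<in>(UNIV :: ('d \<times> bool) set). Z)"
      unfolding Z_def using Hp_pos dx_pos
      by (intro mult_left_mono sum_mono sum_nb_le) (auto simp: z)
    also have "\<dots> = (Hp * real CARD('d) * Z) / dx / 2" by (simp add: field_simps)
    also have "\<dots> \<le> 4 * ((Hp * real CARD('d) * Z) / dx)"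
    proof -
      have "0 \<le> (Hp * real CARD('d) * Z) / dx" using Hp_pos dx_pos Z by simp
      moreover have "t / 2 \<le> 4 * t" if "0 \<le> t" for t :: real using that by simp
      ultimately show ?thesis by blast
    qed
    finally show ?thesis by (simp add: mult_ac)
  qed
  have "0 \<le> 4 / R\<^sup>2 * (\<Sum>l\<in>UNIV. \<nu> l) * Z"
    using Z \<nu>_pos by (intro mult_nonneg_nonneg sum_nonneg) (auto simp: less_imp_le)
  moreover have "8 / R\<^sup>2 * (\<Sum>l\<in>UNIV. \<nu> l) * Z = 2 * (4 / R\<^sup>2 * (\<Sum>l\<in>UNIV. \<nu> l) * Z)" by simp
  moreover have "a - t \<le> b - t" if "0 \<le> a" "b = 2 * a" for a b t :: real using that by simp
  ultimately have "m * Z \<le> 8 / R\<^sup>2 * (\<Sum>l\<in>UNIV. \<nu> l) * Z - 4 * Hp * real CARD('d) / dx * Z"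
    unfolding m_def left_diff_distrib by blast
  also have "\<dots> \<le> (\<Sum>i\<in>interior_nodes. (\<Sum>k\<in>UNIV. \<nu> (fst k) / dx\<^sup>2 * (z $ i * (z $ i - z $ nb i k)))
      - (\<Sum>k\<in>UNIV. Hp / (4 * dx) * (z $ nb i k)\<^sup>2))"
    unfolding sum_subtractf using diffusion transport by linarith
  also have "\<dots> \<le> (\<Sum>i\<in>interior_nodes. z $ i * (A *v z) $ i)"
    by (rule sum_mono) (rule local_bound)
  finally show ?thesis by (simp add: Z_def)
qed

section \<open>Row and column sums\<close>

text \<open>
  A common bound for the off-diagonal part of the row sums and the column sums.
\<close>

definition coupling :: real where
  "coupling = (\<Sum>k\<in>(UNIV :: ('d \<times> bool) set). \<nu> (fst k) / dx\<^sup>2 + Hp / dx)"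

lemma coupling_eq: "coupling = 2 / dx\<^sup>2 * (\<Sum>l\<in>UNIV. \<nu> l) + 2 * real CARD('d) * Hp / dx"
  unfolding coupling_def sum_directions
  by (simp add: sum.distrib sum_distrib_left sum_divide_distrib[symmetric] mult_ac
      flip: sum_distrib_right)

lemma neighbour_matrix_sums:
  fixes b :: "'d \<times> bool \<Rightarrow> real"
  assumes b: "\<And>k. 0 \<le> b k"
  shows "(\<Sum>j\<in>UNIV. \<Sum>k\<in>UNIV. if nb i k = j then b k else 0) = sum b UNIV"
    and "(\<Sum>i\<in>interior_nodes. \<Sum>k\<in>UNIV. if nb i k = j then b k else 0) \<le> sum b UNIV"
proof -
  show "(\<Sum>j\<in>UNIV. \<Sum>k\<in>UNIV. if nb i k = j then b k else 0) = sum b UNIV"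
    by (subst sum.swap) simp
  have "(\<Sum>i\<in>interior_nodes. if nb i k = j then b k else 0) \<le> b k" for k
  proof (cases "\<exists>i\<in>interior_nodes. nb i k = j")
    case True
    then obtain i where i: "i \<in> interior_nodes" "nb i k = j" by blast
    then have "(nb i' k = j) = (i' = i)" if "i' \<in> interior_nodes" for i'
      using that nb_inj_on[of k] by (auto simp: inj_on_def)
    then have "(\<Sum>i\<in>interior_nodes. if nb i k = j then b k else 0) = (\<Sum>i'\<in>interior_nodes. if i' = i then b k else 0)"
      by (intro sum.cong) auto
    then show ?thesis using i by simp
  next
    case False
    then have "(\<Sum>i\<in>interior_nodes. if nb i k = j then b k else 0) = 0"
      by (intro sum.neutral) auto
    then show ?thesis using b by simp
  qed
  then show "(\<Sum>i\<in>interior_nodes. \<Sum>k\<in>UNIV. if nb i k = j then b k else 0) \<le> sum b UNIV"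
    by (subst sum.swap) (intro sum_mono)
qed

lemma entry_bounds:
  assumes A: "A \<in> row_family rows" and i: "i \<in> interior_nodes"
  shows "i \<noteq> j \<Longrightarrow> \<bar>A $ i $ j\<bar> \<le> (\<Sum>k\<in>UNIV. if nb i k = j then \<nu> (fst k) / dx\<^sup>2 + Hp / dx else 0)"
    and "\<bar>A $ i $ j\<bar> \<le> (if i = j then Hu + 2 / dx\<^sup>2 * (\<Sum>l\<in>UNIV. \<nu> l) + Hp / dx else 0)
      + (\<Sum>k\<in>UNIV. if nb i k = j then \<nu> (fst k) / dx\<^sup>2 + Hp / dx else 0)"
proof -
  obtain h c where hc: "0 \<le> h" "h \<le> Hu" "c \<in> slopes" "A $ i = stencil_row i h c"
    using interior_rowE[OF A i] by metis
  let ?a = "\<lambda>k. \<nu> (fst k) / dx\<^sup>2 + c $ k / dx"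
  let ?D = "if i = j then h + (\<Sum>k\<in>UNIV. ?a k) else 0"
  let ?S = "\<Sum>k\<in>UNIV. if nb i k = j then ?a k else 0"
  have a: "0 \<le> ?a k" for k by (rule weight_nonneg[OF hc(3)])
  have "0 \<le> ?S" by (intro sum_nonneg) (simp add: a)
  moreover have "0 \<le> ?D" using hc(1) a by (simp add: sum_nonneg)
  moreover have S: "?S \<le> (\<Sum>k\<in>UNIV. if nb i k = j then \<nu> (fst k) / dx\<^sup>2 + Hp / dx else 0)"
    using slopes_le[OF hc(3)] dx_pos by (intro sum_mono) (simp add: divide_right_mono)
  moreover have "(\<Sum>k\<in>UNIV. ?a k) \<le> 2 / dx\<^sup>2 * (\<Sum>l\<in>UNIV. \<nu> l) + Hp / dx"
  proof -
    have "(\<Sum>k\<in>(UNIV :: ('d \<times> bool) set). \<nu> (fst k) / dx\<^sup>2) = 2 / dx\<^sup>2 * (\<Sum>l\<in>UNIV. \<nu> l)"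
      unfolding sum_directions by (simp add: sum_distrib_left)
    moreover have "(\<Sum>k\<in>UNIV. c $ k / dx) \<le> Hp / dx"
      unfolding sum_divide_distrib[symmetric] using slopes_sum[OF hc(3)] dx_pos by (intro divide_right_mono) auto
    ultimately show ?thesis by (simp add: sum.distrib)
  qed
  moreover have "A $ i $ j = ?D - ?S" by (simp only: hc(4) stencil_row_nth)
  ultimately show "i \<noteq> j \<Longrightarrow> \<bar>A $ i $ j\<bar> \<le> (\<Sum>k\<in>UNIV. if nb i k = j then \<nu> (fst k) / dx\<^sup>2 + Hp / dx else 0)"
    "\<bar>A $ i $ j\<bar> \<le> (if i = j then Hu + 2 / dx\<^sup>2 * (\<Sum>l\<in>UNIV. \<nu> l) + Hp / dx else 0)
      + (\<Sum>k\<in>UNIV. if nb i k = j then \<nu> (fst k) / dx\<^sup>2 + Hp / dx else 0)"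
    using hc(2) by (auto split: if_splits)
qed

lemma coupling_weight_nonneg: "0 \<le> \<nu> (fst k) / dx\<^sup>2 + Hp / dx"
  using \<nu>_pos[of "fst k"] dx_pos Hp_pos by simp

lemma coupling_nonneg: "0 \<le> coupling"
  unfolding coupling_def by (intro sum_nonneg coupling_weight_nonneg)

lemma norm_le_coupling:
  assumes A: "A \<in> row_family rows"
  shows "norm (A *v x) \<le> (max (Hu + 2 / dx\<^sup>2 * (\<Sum>l\<in>UNIV. \<nu> l) + Hp / dx) lb + coupling) * norm x"
proof (rule schur_test)
  let ?b = "\<lambda>k :: 'd \<times> bool. \<nu> (fst k) / dx\<^sup>2 + Hp / dx"
  let ?N = "\<lambda>i j. \<Sum>k\<in>UNIV. if nb i k = j then ?b k else 0"
  let ?D = "max (Hu + 2 / dx\<^sup>2 * (\<Sum>l\<in>UNIV. \<nu> l) + Hp / dx) lb"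
  have N: "0 \<le> ?N i j" for i j by (intro sum_nonneg) (simp add: coupling_weight_nonneg)
  have entry: "\<bar>A $ i $ j\<bar> \<le> (if i = j then ?D else 0) + (if i \<in> interior_nodes then ?N i j else 0)" for i j
  proof (cases "i \<in> interior_nodes")
    case True
    then show ?thesis using entry_bounds(2)[OF A True, of j] by (auto split: if_splits)
  next
    case False
    then show ?thesis using lb_pos by (simp add: boundary_row[OF A False] axis_def)
  qed
  show "(\<Sum>j\<in>UNIV. \<bar>A $ i $ j\<bar>) \<le> ?D + coupling" for i
  proof -
    have "(\<Sum>j\<in>UNIV. \<bar>A $ i $ j\<bar>) \<le> (\<Sum>j\<in>UNIV. (if i = j then ?D else 0) + ?N i j)"
      by (rule sum_mono, rule order_trans[OF entry]) (use N in auto)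
    also have "\<dots> = ?D + coupling"
      unfolding sum.distrib neighbour_matrix_sums(1)[OF coupling_weight_nonneg] coupling_def by simp
    finally show ?thesis .
  qed
  show "(\<Sum>i\<in>UNIV. \<bar>A $ i $ j\<bar>) \<le> ?D + coupling" for j
  proof -
    have "(\<Sum>i\<in>UNIV. \<bar>A $ i $ j\<bar>) \<le>
        (\<Sum>i\<in>UNIV. (if i = j then ?D else 0) + (if i \<in> interior_nodes then ?N i j else 0))"
      by (rule sum_mono) (rule entry)
    also have "\<dots> = ?D + (\<Sum>i\<in>interior_nodes. ?N i j)"
      by (simp add: sum.distrib sum.If_cases)
    also have "\<dots> \<le> ?D + coupling"
      unfolding coupling_def
      by (intro add_left_mono neighbour_matrix_sums(2) coupling_weight_nonneg)
    finally show ?thesis .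
  qed
qed

text \<open>
  Only the block from boundary to interior nodes acts on such a \<open>y\<close>. It has no
  diagonal entries, so its row and column sums are at most \<open>coupling\<close>.
\<close>

lemma interior_boundary_coupling:
  fixes y :: "real ^ 'v"
  assumes A: "A \<in> row_family rows" and y: "\<And>i. i \<in> interior_nodes \<Longrightarrow> y $ i = 0"
  shows "(\<Sum>i\<in>interior_nodes. ((A *v y) $ i)\<^sup>2) \<le> (coupling * norm y)\<^sup>2"
proof -
  let ?b = "\<lambda>k :: 'd \<times> bool. \<nu> (fst k) / dx\<^sup>2 + Hp / dx"
  let ?N = "\<lambda>i j. \<Sum>k\<in>UNIV. if nb i k = j then ?b k else 0"
  have N: "0 \<le> ?N i j" for i j by (intro sum_nonneg) (simp add: coupling_weight_nonneg)
  \<comment> \<open>The block of \<open>A\<close> that couples interior rows to boundary columns.\<close>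
  define E :: "real ^ 'v ^ 'v" where
    "E = (\<chi> i j. if i \<in> interior_nodes \<and> j \<notin> interior_nodes then A $ i $ j else 0)"
  have entry: "\<bar>E $ i $ j\<bar> \<le> (if i \<in> interior_nodes then ?N i j else 0)" for i j
    using entry_bounds(1)[OF A, of i j] N[of i j] by (auto simp: E_def)
  have "norm (E *v y) \<le> coupling * norm y"
  proof (rule schur_test)
    show "(\<Sum>j\<in>UNIV. \<bar>E $ i $ j\<bar>) \<le> coupling" for i
    proof -
      have "(\<Sum>j\<in>UNIV. \<bar>E $ i $ j\<bar>) \<le> (\<Sum>j\<in>UNIV. ?N i j)"
        by (rule sum_mono, rule order_trans[OF entry]) (use N in auto)
      then show ?thesis
        unfolding neighbour_matrix_sums(1)[OF coupling_weight_nonneg] coupling_def .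
    qed
    show "(\<Sum>i\<in>UNIV. \<bar>E $ i $ j\<bar>) \<le> coupling" for j
    proof -
      have "(\<Sum>i\<in>UNIV. \<bar>E $ i $ j\<bar>) \<le> (\<Sum>i\<in>UNIV. if i \<in> interior_nodes then ?N i j else 0)"
        by (rule sum_mono) (rule entry)
      also have "\<dots> = (\<Sum>i\<in>interior_nodes. ?N i j)" by (simp add: sum.If_cases)
      also have "\<dots> \<le> coupling"
        unfolding coupling_def by (intro neighbour_matrix_sums(2) coupling_weight_nonneg)
      finally show ?thesis .
    qed
  qed
  then have "(norm (E *v y))\<^sup>2 \<le> (coupling * norm y)\<^sup>2" by (rule power_mono) simp
  moreover have "(\<Sum>i\<in>interior_nodes. ((A *v y) $ i)\<^sup>2) \<le> (norm (E *v y))\<^sup>2"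
  proof -
    have "(A *v y) $ i = (E *v y) $ i" if "i \<in> interior_nodes" for i
      using that y by (auto simp: matrix_vector_mult_def E_def intro!: sum.cong)
    then have "(\<Sum>i\<in>interior_nodes. ((A *v y) $ i)\<^sup>2) = (\<Sum>i\<in>interior_nodes. ((E *v y) $ i)\<^sup>2)"
      by simp
    also have "\<dots> \<le> (norm (E *v y))\<^sup>2"
      unfolding norm_squared_vec by (rule sum_mono2) auto
    finally show ?thesis .
  qed
  ultimately show ?thesis by linarith
qed

section \<open>Stability in the Euclidean norm\<close>

text \<open>
  The boundary part \<open>y\<close> of \<open>x\<close> is the boundary part of \<open>A x\<close> divided by \<open>lb\<close>. The interior part \<open>z\<close> solves
  \<open>A z = A x - A y\<close> in the interior, where coercivity applies. Since \<open>coupling \<le> lb\<close>, the term \<open>A y\<close> is no larger than the boundary part of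
  \<open>A x\<close>, so that the interior residual and the coupling term together cost \<open>2 / m\<^sup>2\<close>.
\<close>

lemma l2_stability:
  assumes A: "A \<in> row_family rows" and m: "0 < m" and lb: "coupling \<le> lb"
  shows "(norm x)\<^sup>2 \<le> (2 / m\<^sup>2 + 1 / lb\<^sup>2) * (norm (A *v x))\<^sup>2"
proof -
  define f where "f = A *v x"
  define z where "z = (\<chi> i. if i \<in> interior_nodes then x $ i else 0)"
  define y where "y = (\<chi> i. if i \<in> interior_nodes then 0 else x $ i)"
  define Z where "Z = (\<Sum>i\<in>interior_nodes. (x $ i)\<^sup>2)"
  define f_in where "f_in = (\<Sum>i\<in>interior_nodes. (f $ i)\<^sup>2)"
  define f_bd where "f_bd = (\<Sum>i\<in>- interior_nodes. (f $ i)\<^sup>2)"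
  have split: "(norm u)\<^sup>2 = (\<Sum>i\<in>interior_nodes. (u $ i)\<^sup>2) + (\<Sum>i\<in>- interior_nodes. (u $ i)\<^sup>2)"
    for u :: "real ^ 'v"
    unfolding norm_squared_vec
    by (subst sum.union_disjoint[symmetric]) auto
  have norm_y: "(norm y)\<^sup>2 = (\<Sum>i\<in>- interior_nodes. (x $ i)\<^sup>2)"
    unfolding split by (simp add: y_def)
  have "f_bd = lb\<^sup>2 * (norm y)\<^sup>2"
    unfolding f_bd_def norm_y sum_distrib_left
    by (intro sum.cong)
       (auto simp: f_def matrix_vector_mult_row boundary_row[OF A] inner_axis' power_mult_distrib)
  then have y_eq: "(norm y)\<^sup>2 = f_bd / lb\<^sup>2" using lb_pos by simp
  have "x = z + y" by (simp add: vec_eq_iff z_def y_def)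
  then have Az: "(A *v z) $ i = f $ i - (A *v y) $ i" for i
    by (simp add: f_def matrix_vector_right_distrib)
  have Ay: "(\<Sum>i\<in>interior_nodes. ((A *v y) $ i)\<^sup>2) \<le> f_bd"
  proof -
    have "(\<Sum>i\<in>interior_nodes. ((A *v y) $ i)\<^sup>2) \<le> (coupling * norm y)\<^sup>2"
      by (rule interior_boundary_coupling[OF A]) (simp add: y_def)
    also have "\<dots> \<le> (lb * norm y)\<^sup>2"
      using lb coupling_nonneg by (intro power_mono mult_right_mono mult_nonneg_nonneg) auto
    also have "\<dots> = f_bd" using \<open>f_bd = lb\<^sup>2 * (norm y)\<^sup>2\<close> by (simp add: power_mult_distrib)
    finally show ?thesis .
  qed
  have "m * Z \<le> (\<Sum>i\<in>interior_nodes. z $ i * (A *v z) $ i)"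
    using interior_coercive[OF A, of z] by (simp add: z_def Z_def)
  also have "\<dots> \<le> (\<Sum>i\<in>interior_nodes. m / 2 * (x $ i)\<^sup>2 + ((f $ i)\<^sup>2 + ((A *v y) $ i)\<^sup>2) / m)"
  proof (rule sum_mono)
    fix i assume i: "i \<in> interior_nodes"
    \<comment> \<open>Two squares absorb the cross terms: \<open>(m x - (r - s))\<^sup>2 + (r + s)\<^sup>2\<close> contains \<open>2 (r\<^sup>2 + s\<^sup>2)\<close> and no product \<open>r s\<close>.\<close>
    let ?r = "f $ i" and ?s = "(A *v y) $ i" and ?x = "x $ i"
    have "0 \<le> ((m * ?x - (?r - ?s))\<^sup>2 + (?r + ?s)\<^sup>2) / (2 * m)" using m by simp
    also have "\<dots> = m / 2 * ?x\<^sup>2 + (?r\<^sup>2 + ?s\<^sup>2) / m - ?x * (?r - ?s)"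
      using m by (simp add: field_simps power2_eq_square)
    finally show "z $ i * (A *v z) $ i \<le> m / 2 * ?x\<^sup>2 + (?r\<^sup>2 + ?s\<^sup>2) / m"
      using i by (simp add: Az) (simp add: z_def)
  qed
  also have "\<dots> = m / 2 * Z + (f_in + (\<Sum>i\<in>interior_nodes. ((A *v y) $ i)\<^sup>2)) / m"
    by (simp add: Z_def f_in_def sum.distrib sum_distrib_left sum_divide_distrib add_divide_distrib)
  also have "\<dots> \<le> m / 2 * Z + (f_in + f_bd) / m"
    using Ay m by (intro add_left_mono divide_right_mono) auto
  finally have "m / 2 * Z \<le> (f_in + f_bd) / m" by (simp add: field_simps)
  then have Z_le: "Z \<le> 2 / m\<^sup>2 * (f_in + f_bd)"
    using m by (simp add: field_simps power2_eq_square)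
  have norm_f: "(norm (A *v x))\<^sup>2 = f_in + f_bd"
    unfolding split f_in_def f_bd_def f_def ..
  have "f_bd \<le> f_in + f_bd" by (simp add: f_in_def sum_nonneg)
  then have "(norm y)\<^sup>2 \<le> 1 / lb\<^sup>2 * (f_in + f_bd)"
    unfolding y_eq using lb_pos by (simp add: divide_right_mono)
  moreover have "(norm x)\<^sup>2 = Z + (norm y)\<^sup>2" unfolding norm_y Z_def by (rule split)
  ultimately show ?thesis
    unfolding norm_f using Z_le by (simp add: distrib_right)
qed

lemma smallness_imp_m_pos:
  assumes "Hp * R\<^sup>2 * real CARD('d) < dx * (\<Sum>l\<in>UNIV. \<nu> l)"
  shows "0 < m" "real CARD('d) * Hp / dx < (\<Sum>l\<in>UNIV. \<nu> l) / R\<^sup>2"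
proof -
  show "real CARD('d) * Hp / dx < (\<Sum>l\<in>UNIV. \<nu> l) / R\<^sup>2"
    using assms R_pos dx_pos by (simp add: field_simps)
  moreover have "m = 4 * ((\<Sum>l\<in>UNIV. \<nu> l) / R\<^sup>2 - real CARD('d) * Hp / dx)"
    by (simp add: m_def right_diff_distrib mult_ac)
  ultimately show "0 < m" by simp
qed

lemma coupling_le_lb:
  assumes "2 * real CARD('d) * (Max (range \<nu>) + Hp * dx) / dx\<^sup>2 \<le> lb"
  shows "coupling \<le> lb"
proof -
  have "(\<Sum>l\<in>UNIV. \<nu> l) \<le> (\<Sum>l\<in>(UNIV :: 'd set). Max (range \<nu>))" by (rule sum_mono) simp
  then have "2 / dx\<^sup>2 * (\<Sum>l\<in>UNIV. \<nu> l) \<le> 2 / dx\<^sup>2 * (real CARD('d) * Max (range \<nu>))"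
    by (intro mult_left_mono) auto
  then have "coupling \<le> 2 * real CARD('d) * (Max (range \<nu>) + Hp * dx) / dx\<^sup>2"
    unfolding coupling_eq using dx_pos
    by (simp add: distrib_left add_divide_distrib power2_eq_square mult_ac)
  then show ?thesis using assms by simp
qed

text \<open>
  Row and column sums of interior nodes exceed the sum of \<open>Hu\<close> and the diffusion part by at most
  \<open>(2 d + 1) Hp / dx\<close>, which the smallness condition bounds by three times the sum of the \<open>\<nu> l\<close> over \<open>R\<^sup>2\<close>.
\<close>

lemma l2_norm_bound:
  assumes A: "A \<in> row_family rows"
    and small: "Hp * R\<^sup>2 * real CARD('d) < dx * (\<Sum>l\<in>UNIV. \<nu> l)" and lb: "coupling \<le> lb"
  shows "norm (A *v x) \<le> max (4 * (1 / dx\<^sup>2 + 1 / R\<^sup>2) * (\<Sum>l\<in>UNIV. \<nu> l) + Hu) (2 * lb) * norm x"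
proof -
  let ?S = "\<Sum>l\<in>UNIV. \<nu> l"
  have "1 \<le> real CARD('d)" by (simp add: Suc_leI)
  then have "Hp / dx \<le> real CARD('d) * Hp / dx"
    using Hp_pos dx_pos by (intro divide_right_mono) auto
  moreover have "0 \<le> ?S / R\<^sup>2" using \<nu>_pos by (intro divide_nonneg_nonneg sum_nonneg) (auto simp: less_imp_le)
  moreover have "a + 2 * b \<le> 4 * c" if "a \<le> b" "0 \<le> c" "b < c" for a b c :: real
    using that by linarith
  ultimately have "Hp / dx + 2 * (real CARD('d) * Hp / dx) \<le> 4 * (?S / R\<^sup>2)"
    using smallness_imp_m_pos(2)[OF small] by blast
  then have "Hu + 2 / dx\<^sup>2 * ?S + Hp / dx + coupling \<le> 4 * (1 / dx\<^sup>2 + 1 / R\<^sup>2) * ?S + Hu"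
    unfolding coupling_eq by (simp add: distrib_left distrib_right)
  then have "max (Hu + 2 / dx\<^sup>2 * ?S + Hp / dx) lb + coupling
      \<le> max (4 * (1 / dx\<^sup>2 + 1 / R\<^sup>2) * ?S + Hu) (2 * lb)"
    using lb by (auto simp: max_def)
  then show ?thesis
    using norm_le_coupling[OF A, of x] by (meson mult_right_mono norm_ge_zero order_trans)
qed

end

section \<open>Well-posedness and error bounds for the scheme\<close>

theorem theorem6:
  fixes \<Omega> :: "(real ^ 'd::finite) set"
    and dx R m lb Hu Hp :: real
    and J B :: "(int ^ 'd) set"
    and \<iota> :: "'v::finite \<Rightarrow> int ^ 'd"
    and \<nu> :: "'d \<Rightarrow> real"
    and H :: "real ^ 'd \<Rightarrow> real \<Rightarrow> real ^ ('d \<times> bool) \<Rightarrow> real"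
    and g :: "int ^ 'd \<Rightarrow> real"
    and F :: "real ^ 'v \<Rightarrow> real ^ 'v"
    and L :: "real ^ 'v \<Rightarrow> real"
  assumes domain: "open \<Omega>" "connected \<Omega>" "\<Omega> \<noteq> {}" "bounded \<Omega>"
    and R: "R = sup_diameter \<Omega>"
    and grid: "uniform_grid \<Omega> dx J B \<iota>"
    and \<nu>_pos: "\<And>l. 0 < \<nu> l"
    and lb_pos: "0 < lb"
    and H1_pos: "0 < Hu" "0 < Hp"
    and H1_u: "\<And>j u v p. j \<in> J \<Longrightarrow>
          \<bar>H (node dx j) u p - H (node dx j) v p\<bar> \<le> Hu * \<bar>u - v\<bar>"
    and H1_p: "\<And>j u p q. j \<in> J \<Longrightarrow>
          \<bar>H (node dx j) u p - H (node dx j) u q\<bar> \<le> Hp * infnorm (p - q)"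
    and H2_p: "\<And>j u p q. j \<in> J \<Longrightarrow> p \<le> q \<Longrightarrow> H (node dx j) u p \<le> H (node dx j) u q"
    and H2_u: "\<And>j u v p. j \<in> J \<Longrightarrow> u \<le> v \<Longrightarrow> H (node dx j) u p \<le> H (node dx j) v p"
    and F: "F = residual \<iota> J dx \<nu> lb H g"
    and L: "L = (\<lambda>u. (norm (F u))\<^sup>2)"
    and m: "m = 4 / R\<^sup>2 * (\<Sum>l\<in>UNIV. \<nu> l) - 4 * Hp * real CARD('d) / dx"
  shows "\<exists>ubar.
    (F ubar = 0 \<and> (\<forall>u. F u = 0 \<longrightarrow> u = ubar) \<and>
     (\<forall>u. 0 \<in> clarke_gradient L u \<longleftrightarrow> u = ubar)) \<and>
    (\<forall>l. dx \<le> sqrt 3 * \<nu> l / (2 * Hp) * exp (- (Hp / \<nu> l * R)) \<longrightarrow>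
      (\<forall>u. infnorm (u - ubar) \<le>
             (\<nu> l / (2 * Hp\<^sup>2) * exp (2 * Hp / \<nu> l * R) + 1 / lb) * infnorm (F u))) \<and>
    (dx * (\<Sum>l\<in>UNIV. \<nu> l) > Hp * R\<^sup>2 * real CARD('d) \<and>
     lb \<ge> 2 * real CARD('d) * (Max (range \<nu>) + Hp * dx) / dx\<^sup>2 \<longrightarrow>
      (\<forall>u. (norm (u - ubar))\<^sup>2 \<le> (2 / m\<^sup>2 + 1 / lb\<^sup>2) * L u) \<and>
      (\<forall>u. \<forall>w\<in>clarke_gradient L u.
         (norm w)\<^sup>2 \<ge> inverse (1 / (2 * m\<^sup>2) + 1 / (4 * lb\<^sup>2)) * L u) \<and>
      (\<forall>u. \<forall>A\<in>generalized_jacobian F u. invertible A \<and>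
         condition_number A \<le> sqrt (2 / m\<^sup>2 + 1 / lb\<^sup>2) *
           max (4 * (1 / dx\<^sup>2 + 1 / R\<^sup>2) * (\<Sum>l\<in>UNIV. \<nu> l) + Hu) (2 * lb)))"
proof -
  interpret grid: grid_scheme \<Omega> dx lb Hu Hp J B \<iota> \<nu>
    using domain(4) grid \<nu>_pos lb_pos H1_pos by unfold_locales
  have R_eq: "R = grid.R" by (simp add: R grid.R_def)
  have m_eq: "m = grid.m" by (simp add: m grid.m_def R_eq)
  have secant: "secant_family F grid.rows"
    unfolding F by (rule grid.residual_secant_family) (fact H1_u H1_p H2_p H2_u)+
  have secantE: "\<exists>A\<in>row_family grid.rows. F u - F v = A *v (u - v)" for u v
    using secant unfolding secant_family_def by blast
  have clarke: "\<exists>A\<in>row_family grid.rows. w = 2 *\<^sub>R (F u v* A)" if "w \<in> clarke_gradient L u" for u w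
    using clarke_gradient_norm_squared_subset[OF secant, of u] that unfolding L by blast
  obtain c where c: "0 \<le> c" "\<And>A x. A \<in> row_family grid.rows \<Longrightarrow> norm x \<le> c * norm (A *v x)"
    using grid.norm_stability by blast
  have lower: "norm (u - v) \<le> c * norm (F u - F v)" for u v
    using secantE[of u v] c(2) by metis
  have "surj F" by (rule secant_family_surj[OF secant c(1) lower])
  then obtain ubar where ubar: "F ubar = 0" by (metis surjD)
  have unique: "u = ubar" if "F u = 0" for u
    using lower[of u ubar] that ubar by simp
  have critical: "0 \<in> clarke_gradient L u \<longleftrightarrow> u = ubar" for u
  proof
    assume "0 \<in> clarke_gradient L u"
    then obtain A where A: "A \<in> row_family grid.rows" "0 = 2 *\<^sub>R (F u v* A)" using clarke by blast
    have "norm (F u) \<le> c * norm (F u v* A)"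
      by (rule transpose_lower_bound[OF c(2)[OF A(1)] c(1)])
    then show "u = ubar" using A(2) unique by simp
  next
    assume "u = ubar"
    then show "0 \<in> clarke_gradient L u"
      unfolding L using zero_in_clarke_gradient_at_zero[OF secant ubar] by simp
  qed
  have sup_bound: "infnorm (u - ubar) \<le>
      (\<nu> l / (2 * Hp\<^sup>2) * exp (2 * Hp / \<nu> l * R) + 1 / lb) * infnorm (F u)" for l u
  proof -
    obtain A where A: "A \<in> row_family grid.rows" "F u - F ubar = A *v (u - ubar)"
      using secantE by blast
    show ?thesis using grid.infnorm_stability[OF A(1), of "u - ubar" l] A(2) ubar R_eq by simp
  qed
  have l2_part: "(\<forall>u. (norm (u - ubar))\<^sup>2 \<le> (2 / m\<^sup>2 + 1 / lb\<^sup>2) * L u) \<and>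
      (\<forall>u. \<forall>w\<in>clarke_gradient L u.
         (norm w)\<^sup>2 \<ge> inverse (1 / (2 * m\<^sup>2) + 1 / (4 * lb\<^sup>2)) * L u) \<and>
      (\<forall>u. \<forall>A\<in>generalized_jacobian F u. invertible A \<and>
         condition_number A \<le> sqrt (2 / m\<^sup>2 + 1 / lb\<^sup>2) *
           max (4 * (1 / dx\<^sup>2 + 1 / R\<^sup>2) * (\<Sum>l\<in>UNIV. \<nu> l) + Hu) (2 * lb))"
    if small: "dx * (\<Sum>l\<in>UNIV. \<nu> l) > Hp * R\<^sup>2 * real CARD('d)"
      and large: "lb \<ge> 2 * real CARD('d) * (Max (range \<nu>) + Hp * dx) / dx\<^sup>2"
  proof -
    define \<gamma> where "\<gamma> = 2 / m\<^sup>2 + 1 / lb\<^sup>2"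
    have small': "Hp * grid.R\<^sup>2 * real CARD('d) < dx * (\<Sum>l\<in>UNIV. \<nu> l)"
      using small by (simp add: R_eq)
    have m_pos: "0 < grid.m" by (rule grid.smallness_imp_m_pos[OF small'])
    have coupling: "grid.coupling \<le> lb" by (rule grid.coupling_le_lb[OF large])
    have \<gamma>: "0 < \<gamma>" using lb_pos by (simp add: \<gamma>_def add_nonneg_pos)
    have stable: "(norm x)\<^sup>2 \<le> \<gamma> * (norm (A *v x))\<^sup>2" if "A \<in> row_family grid.rows" for A x
      unfolding \<gamma>_def m_eq by (rule grid.l2_stability[OF that m_pos coupling])
    have stable_sqrt: "norm x \<le> sqrt \<gamma> * norm (A *v x)" if "A \<in> row_family grid.rows" for A x
      using real_sqrt_le_mono[OF stable[OF that, of x]] by (simp add: real_sqrt_mult)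
    have "(norm (u - ubar))\<^sup>2 \<le> \<gamma> * L u" for u
    proof -
      obtain A where "A \<in> row_family grid.rows" "F u - F ubar = A *v (u - ubar)"
        using secantE by blast
      then show ?thesis using stable[of A "u - ubar"] by (simp add: L ubar)
    qed
    moreover have "(norm w)\<^sup>2 \<ge> inverse (1 / (2 * m\<^sup>2) + 1 / (4 * lb\<^sup>2)) * L u"
      if w: "w \<in> clarke_gradient L u" for u w
    proof -
      obtain A where A: "A \<in> row_family grid.rows" "w = 2 *\<^sub>R (F u v* A)" using clarke[OF w] by blast
      have "norm (F u) \<le> sqrt \<gamma> * norm (F u v* A)"
        by (rule transpose_lower_bound[OF stable_sqrt[OF A(1)]]) (use \<gamma> in simp)
      then have "(norm (F u))\<^sup>2 \<le> (sqrt \<gamma> * norm (F u v* A))\<^sup>2" by (rule power_mono) simp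
      then have "L u \<le> \<gamma> * (norm w)\<^sup>2 / 4"
        using \<gamma> by (simp add: L A(2) power_mult_distrib)
      then have "4 / \<gamma> * L u \<le> (norm w)\<^sup>2" using \<gamma> by (simp add: field_simps)
      moreover have "1 / (2 * m\<^sup>2) + 1 / (4 * lb\<^sup>2) = \<gamma> / 4" by (simp add: \<gamma>_def add_divide_distrib)
      ultimately show ?thesis by (simp only: inverse_divide)
    qed
    moreover have "invertible A \<and> condition_number A \<le> sqrt \<gamma> *
        max (4 * (1 / dx\<^sup>2 + 1 / R\<^sup>2) * (\<Sum>l\<in>UNIV. \<nu> l) + Hu) (2 * lb)"
      if "A \<in> generalized_jacobian F u" for u A
    proof -
      have A: "A \<in> row_family grid.rows" using generalized_jacobian_subset[OF secant] that by blast
      show ?thesis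
        using condition_number_le[OF stable_sqrt[OF A] grid.l2_norm_bound[OF A small' coupling]] \<gamma> lb_pos
        by (simp add: R_eq max.coboundedI2)
    qed
    ultimately show ?thesis unfolding \<gamma>_def by blast
  qed
  show ?thesis
    using ubar unique critical sup_bound l2_part by (intro exI[of _ ubar]) blast
qed

end
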